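(* Let $\rho \in (0,+\infty)$ and set $\Pi_\rho=[0,1]\times[-\rho,\rho]^3$. Write $\partial B_\rho=\{u\in C^2[0,1] : \|u\|_2=\rho\}$ and $\overline{B_\rho}=\{u\in C^2[0,1] : \|u\|_2\le\rho\}$. Assume that the following conditions hold. (1) $f:\Pi_\rho\to\mathbb{R}$ is continuous and there exists a continuous function $\underline{\delta}_\rho:[0,1]\to[0,+\infty)$ such that one of the following conditions holds: (1a) $f(t,u,v,w)\ge \underline{\delta}_\rho(t)$ for every $(t,u,v,w)\in \Pi_{\rho}$; (1b) $-f(t,u,v,w)\ge \underline{\delta}_\rho(t)$ for every $(t,u,v,w)\in \Pi_{\rho}$. (2) $H_1,H_2: \overline{B_\rho}\to \mathbb{R}$ are continuous and bounded, and $\underline{\eta_1}_\rho, \underline{\eta_2}_\rho \in \mathbb{R}$ are such that $H_i[u]\ge \underline{\eta_i}_\rho$ for every $u \in \partial B_\rho$ and $i\in \{1,2\}$. (3) One of the following two conditions holds: (3a) (1a) holds and $$6\big(\underline{\eta_1}_\rho+\underline{\eta_2}_\rho\big)+\int_{0}^{1} (1-s)^2(2s+1)\,\underline{\delta}_\rho(s)\,ds>0;$$ (3b) (1b) holds and $$6\big(\underline{\eta_1}_\rho+\underline{\eta_2}_\rho\big)+\int_{0}^{1} s^2(3-2s)\,\underline{\delta}_\rho(s)\,ds>0.$$ Then the boundary value problem $$\begin{cases} u'''(t)+\lambda f(t,u(t),u'(t),u''(t))=0 , \quad t \in (0,1), \\ u(0)=\lambda H_1[u],\quad u(1)=\lambda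 H_2[u],\quad \int_{0}^{1} u(t)\,dt=0, \end{cases}$$ has a positive eigenvalue $\lambda_\rho^+$ with an associated eigenfunction $u_\rho^+\in \partial B_\rho$ and a negative eigenvalue $\lambda_\rho^-$ with an associated eigenfunction $u_\rho^-\in \partial B_\rho$ (eigenvalues and eigenfunctions being understood in the sense of the associated perturbed Hammerstein integral equation given in the context).
   Context: The space $C^2[0,1]$ of real-valued functions is endowed with the norm $\|u\|_2:=\max_{j=0,1,2}\|u^{(j)}\|_\infty$, where $\|w\|_\infty=\sup_{t\in[0,1]}|w(t)|$. Continuity and boundedness of $H_1,H_2$ are with respect to this norm (bounded means having bounded image on the closed ball). Let $$k(t,s)=\frac{1}{2}\begin{cases} s^2(1-t)(3t-2ts-1), & 0\le s\le t\le 1, \\ t(1-s)^2(2ts+t-2s), & 0 \le t\le s\le 1, \end{cases}$$ and $\gamma_1(t)=1-4t+3t^2$, $\gamma_2(t)=-2t+3t^2$ for $t\in[0,1]$. Definition. $\lambda\in\mathbb{R}$ is an eigenvalue of the boundary value problem with a corresponding (associated) eigenfunction $u\in C^2[0,1]$ if $\|u\|_2>0$ and the pair $(u,\lambda)$ satisfies the perturbed Hammerstein integral equation $$u(t)=\lambda\Bigl(\gamma_1(t)H_1[u]+\gamma_2(t)H_2[u]+\int_{0}^{1}k(t,s)f(s,u(s),u'(s),u''(s))\,ds\Bigr),\quad t\in[0,1].$$ *)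

theory Defs
  imports "HOL-Analysis.Analysis"
begin

text \<open>
  The space C^2[0,1]. Derivatives are taken within [0,1], so they are one-sided at the
  end points and depend only on the restriction of the function to [0,1].
\<close>

definition deriv01 :: "(real \<Rightarrow> real) \<Rightarrow> real \<Rightarrow> real"
  where "deriv01 u t = vector_derivative u (at t within {0..1})"

definition C2_on01 :: "(real \<Rightarrow> real) \<Rightarrow> bool"
  where "C2_on01 u \<longleftrightarrow>
    u differentiable_on {0..1} \<and>
    deriv01 u differentiable_on {0..1} \<and>
    continuous_on {0..1} (deriv01 (deriv01 u))"

definition supnorm01 :: "(real \<Rightarrow> real) \<Rightarrow> real"
  where "supnorm01 w = (SUP t\<in>{0..1}. \<bar>w t\<bar>)"

definition C2_norm01 :: "(real \<Rightarrow> real) \<Rightarrow> real"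
  where "C2_norm01 u =
    max (supnorm01 u) (max (supnorm01 (deriv01 u)) (supnorm01 (deriv01 (deriv01 u))))"

lemma deriv01_unique:
  assumes "(u has_vector_derivative d) (at t within {0..1})" "t \<in> {0..1}"
  shows "deriv01 u t = d"
  unfolding deriv01_def
  using vector_derivative_within_closed_interval[of 0 1 t u d] assms by simp

lemma deriv01_works:
  assumes "u differentiable_on {0..1}" "t \<in> {0..1}"
  shows "(u has_vector_derivative deriv01 u t) (at t within {0..1})"
  using assms unfolding deriv01_def differentiable_on_def vector_derivative_works by blast

lemma deriv01_lincomb:
  assumes "u differentiable_on {0..1}" "v differentiable_on {0..1}"
    and w: "\<And>t. t \<in> {0..1} \<Longrightarrow> w t = a * u t + b * v t"
  shows "w differentiable_on {0..1}"
    and "\<And>t. t \<in> {0..1} \<Longrightarrow> deriv01 w t = a * deriv01 u t + b * deriv01 v t"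
proof -
  have der: "(w has_vector_derivative a * deriv01 u t + b * deriv01 v t) (at t within {0..1})"
    if t: "t \<in> {0..1}" for t
  proof -
    have "((\<lambda>t. a * u t + b * v t) has_vector_derivative a * deriv01 u t + b * deriv01 v t)
      (at t within {0..1})"
      by (intro has_vector_derivative_add has_vector_derivative_mult_right
          deriv01_works assms t)
    then show ?thesis
      by (rule has_vector_derivative_transform_within[OF _ zero_less_one t]) (simp add: w)
  qed
  show "w differentiable_on {0..1}"
    unfolding differentiable_on_def using der differentiableI_vector by blast
  show "\<And>t. t \<in> {0..1} \<Longrightarrow> deriv01 w t = a * deriv01 u t + b * deriv01 v t"
    using der deriv01_unique by blast
qed

lemma C2_on01_lincomb:
  fixes a b :: real
  assumes u: "C2_on01 u" and v: "C2_on01 v"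
  defines "w \<equiv> \<lambda>t. a * u t + b * v t"
  shows "C2_on01 w"
    and "\<And>t. t \<in> {0..1} \<Longrightarrow> deriv01 w t = a * deriv01 u t + b * deriv01 v t"
    and "\<And>t. t \<in> {0..1} \<Longrightarrow> deriv01 (deriv01 w) t
      = a * deriv01 (deriv01 u) t + b * deriv01 (deriv01 v) t"
proof -
  have 1: "w differentiable_on {0..1}"
    and 2: "\<And>t. t \<in> {0..1} \<Longrightarrow> deriv01 w t = a * deriv01 u t + b * deriv01 v t"
    using deriv01_lincomb[of u v w a b] u v unfolding C2_on01_def w_def by auto
  have 3: "deriv01 w differentiable_on {0..1}"
    and 4: "\<And>t. t \<in> {0..1} \<Longrightarrow> deriv01 (deriv01 w) t
      = a * deriv01 (deriv01 u) t + b * deriv01 (deriv01 v) t"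
    using deriv01_lincomb[of "deriv01 u" "deriv01 v" "deriv01 w" a b] u v 2
    unfolding C2_on01_def by auto
  have "continuous_on {0..1} (\<lambda>t. a * deriv01 (deriv01 u) t + b * deriv01 (deriv01 v) t)"
    using u v unfolding C2_on01_def by (intro continuous_intros) auto
  then have "continuous_on {0..1} (deriv01 (deriv01 w))"
    by (subst continuous_on_cong[OF refl 4]) auto
  then show "C2_on01 w"
    unfolding C2_on01_def using 1 3 by blast
  show "\<And>t. t \<in> {0..1} \<Longrightarrow> deriv01 w t = a * deriv01 u t + b * deriv01 v t" by (rule 2)
  show "\<And>t. t \<in> {0..1} \<Longrightarrow> deriv01 (deriv01 w) t
      = a * deriv01 (deriv01 u) t + b * deriv01 (deriv01 v) t" by (rule 4)
qed

lemma C2_on01_0: "C2_on01 (\<lambda>t. 0)"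
proof -
  have 1: "deriv01 (\<lambda>t. 0) t = 0" if "t \<in> {0..1}" for t
    using that by (intro deriv01_unique) auto
  have 2: "deriv01 (\<lambda>t. 0) differentiable_on {0..1}"
    using deriv01_lincomb(1)[of "\<lambda>t. 0" "\<lambda>t. 0" "deriv01 (\<lambda>t. 0)" 0 0] 1 by simp
  have "deriv01 (deriv01 (\<lambda>t. 0)) t = 0" if "t \<in> {0..1}" for t
    using deriv01_lincomb(2)[of "\<lambda>t. 0" "\<lambda>t. 0" "deriv01 (\<lambda>t. 0)" 0 0] 1 that by simp
  then have "continuous_on {0..1} (deriv01 (deriv01 (\<lambda>t. 0)))"
    by (subst continuous_on_cong[OF refl]) (auto simp: continuous_on_const)
  then show ?thesis
    using 2 by (simp add: C2_on01_def)
qed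

lemma supnorm01_bdd:
  fixes w :: "real \<Rightarrow> real"
  assumes "continuous_on {0..1} w"
  shows "bdd_above ((\<lambda>t. \<bar>w t\<bar>) ` {0..1})"
proof -
  have "continuous_on {0..1} (\<lambda>t. \<bar>w t\<bar>)"
    using assms by (intro continuous_intros)
  then show ?thesis
    by (intro bounded_imp_bdd_above compact_imp_bounded compact_continuous_image) auto
qed

lemma supnorm01_upper:
  assumes "continuous_on {0..1} w" "t \<in> {0..1}"
  shows "\<bar>w t\<bar> \<le> supnorm01 w"
  unfolding supnorm01_def using assms by (intro cSUP_upper supnorm01_bdd)

lemma supnorm01_least:
  assumes "\<And>t. t \<in> {0..1} \<Longrightarrow> \<bar>w t\<bar> \<le> c"
  shows "supnorm01 w \<le> c"
  unfolding supnorm01_def using assms by (intro cSUP_least) auto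

lemma supnorm01_cong:
  assumes "\<And>t. t \<in> {0..1} \<Longrightarrow> w t = w' t"
  shows "supnorm01 w = supnorm01 w'"
  unfolding supnorm01_def using assms by (intro SUP_cong) auto

lemma supnorm01_nonneg:
  assumes "continuous_on {0..1} w"
  shows "0 \<le> supnorm01 w"
  using supnorm01_upper[OF assms, of 0] by simp

lemma supnorm01_triangle:
  assumes "continuous_on {0..1} u" "continuous_on {0..1} v"
    and "\<And>t. t \<in> {0..1} \<Longrightarrow> w t = u t + v t"
  shows "supnorm01 w \<le> supnorm01 u + supnorm01 v"
proof (rule supnorm01_least)
  fix t :: real assume t: "t \<in> {0..1}"
  show "\<bar>w t\<bar> \<le> supnorm01 u + supnorm01 v"
    using supnorm01_upper[OF assms(1) t] supnorm01_upper[OF assms(2) t] assms(3)[OF t]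
    by linarith
qed

lemma supnorm01_scale_le:
  assumes "continuous_on {0..1} u"
    and "\<And>t. t \<in> {0..1} \<Longrightarrow> w t = a * u t"
  shows "supnorm01 w \<le> \<bar>a\<bar> * supnorm01 u"
  using assms supnorm01_upper[OF assms(1)]
  by (intro supnorm01_least) (simp add: abs_mult mult_left_mono)

lemma supnorm01_scale:
  assumes u: "continuous_on {0..1} u"
    and w: "\<And>t. t \<in> {0..1} \<Longrightarrow> w t = a * u t"
  shows "supnorm01 w = \<bar>a\<bar> * supnorm01 u"
proof (cases "a = 0")
  case True
  then show ?thesis
    using w by (simp add: supnorm01_def)
next
  case False
  have "continuous_on {0..1} (\<lambda>t. a * u t)"
    using u by (intro continuous_intros)
  then have "continuous_on {0..1} w"
    by (subst continuous_on_cong[OF refl w])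
  then have "supnorm01 u \<le> \<bar>inverse a\<bar> * supnorm01 w"
    using w False by (intro supnorm01_scale_le) auto
  then have "\<bar>a\<bar> * supnorm01 u \<le> supnorm01 w"
    using False by (simp add: abs_inverse field_simps)
  then show ?thesis
    using supnorm01_scale_le[OF u w] by simp
qed

lemma C2_on01_continuous:
  assumes "C2_on01 u"
  shows "continuous_on {0..1} u" "continuous_on {0..1} (deriv01 u)"
    "continuous_on {0..1} (deriv01 (deriv01 u))"
  using assms differentiable_imp_continuous_on unfolding C2_on01_def by auto

lemma C2_norm01_triangle:
  assumes "C2_on01 u" "C2_on01 v"
  shows "C2_norm01 (\<lambda>t. u t + v t) \<le> C2_norm01 u + C2_norm01 v"
proof -
  note l = C2_on01_lincomb[OF assms, where a = 1 and b = 1, unfolded mult_1]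
  note c = C2_on01_continuous[OF assms(1)] C2_on01_continuous[OF assms(2)]
  have "supnorm01 (\<lambda>t. u t + v t) \<le> supnorm01 u + supnorm01 v"
    by (rule supnorm01_triangle[OF c(1) c(4)]) simp
  moreover have "supnorm01 (deriv01 (\<lambda>t. u t + v t)) \<le> supnorm01 (deriv01 u) + supnorm01 (deriv01 v)"
    by (rule supnorm01_triangle[OF c(2) c(5) l(2)])
  moreover have "supnorm01 (deriv01 (deriv01 (\<lambda>t. u t + v t)))
      \<le> supnorm01 (deriv01 (deriv01 u)) + supnorm01 (deriv01 (deriv01 v))"
    by (rule supnorm01_triangle[OF c(3) c(6) l(3)])
  ultimately show ?thesis
    unfolding C2_norm01_def by linarith
qed

lemma C2_norm01_scale:
  assumes "C2_on01 u"
  shows "C2_norm01 (\<lambda>t. a * u t) = \<bar>a\<bar> * C2_norm01 u"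
proof -
  note l = C2_on01_lincomb[OF assms assms, where a = a and b = 0, unfolded mult_zero_left add_0_right]
  note c = C2_on01_continuous[OF assms]
  have "supnorm01 (\<lambda>t. a * u t) = \<bar>a\<bar> * supnorm01 u"
    by (rule supnorm01_scale[OF c(1)]) simp
  moreover have "supnorm01 (deriv01 (\<lambda>t. a * u t)) = \<bar>a\<bar> * supnorm01 (deriv01 u)"
    by (rule supnorm01_scale[OF c(2) l(2)])
  moreover have "supnorm01 (deriv01 (deriv01 (\<lambda>t. a * u t)))
      = \<bar>a\<bar> * supnorm01 (deriv01 (deriv01 u))"
    by (rule supnorm01_scale[OF c(3) l(3)])
  ultimately show ?thesis
    unfolding C2_norm01_def by (simp add: max_mult_distrib_left)
qed

text \<open>
  An element of C^2[0,1] is represented by its extension by zero to the whole real line, which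
  makes the representation unique; the values outside [0,1] play no role.
\<close>

typedef C2_01 = "{u :: real \<Rightarrow> real. C2_on01 u \<and> (\<forall>t. t \<notin> {0..1} \<longrightarrow> u t = 0)}"
  morphisms C2_fun C2_Abs
  using C2_on01_0 by (intro exI[of _ "\<lambda>t. 0"]) simp

setup_lifting type_definition_C2_01

instantiation C2_01 :: real_normed_vector
begin

lift_definition zero_C2_01 :: C2_01 is "\<lambda>t. 0"
  by (simp add: C2_on01_0)

lift_definition plus_C2_01 :: "C2_01 \<Rightarrow> C2_01 \<Rightarrow> C2_01" is "\<lambda>u v t. u t + v t"
  using C2_on01_lincomb(1)[where a = 1 and b = 1] by simp

lift_definition minus_C2_01 :: "C2_01 \<Rightarrow> C2_01 \<Rightarrow> C2_01" is "\<lambda>u v t. u t - v t"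
  using C2_on01_lincomb(1)[where a = 1 and b = "-1"] by simp

lift_definition uminus_C2_01 :: "C2_01 \<Rightarrow> C2_01" is "\<lambda>u t. - u t"
  using C2_on01_lincomb(1)[OF _ C2_on01_0, where a = "-1"] by simp

lift_definition scaleR_C2_01 :: "real \<Rightarrow> C2_01 \<Rightarrow> C2_01" is "\<lambda>a u t. a * u t"
  using C2_on01_lincomb(1)[OF _ C2_on01_0] by simp

lift_definition norm_C2_01 :: "C2_01 \<Rightarrow> real" is C2_norm01 .

definition dist_C2_01 :: "C2_01 \<Rightarrow> C2_01 \<Rightarrow> real"
  where "dist_C2_01 u v = norm (u - v)"

definition sgn_C2_01 :: "C2_01 \<Rightarrow> C2_01"
  where "sgn_C2_01 u = inverse (norm u) *\<^sub>R u"

definition uniformity_C2_01 :: "(C2_01 \<times> C2_01) filter"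
  where "uniformity_C2_01 = (INF e\<in>{0<..}. principal {(u, v). dist u v < e})"

definition open_C2_01 :: "C2_01 set \<Rightarrow> bool"
  where "open_C2_01 S = (\<forall>u\<in>S. \<forall>\<^sub>F (u', v) in uniformity. u' = u \<longrightarrow> v \<in> S)"

instance
proof
  fix u v w :: C2_01 and a b :: real
  show "dist u v = norm (u - v)" by (rule dist_C2_01_def)
  show "sgn u = inverse (norm u) *\<^sub>R u" by (rule sgn_C2_01_def)
  show "uniformity = (INF e\<in>{0<..}. principal {(u::C2_01, v). dist u v < e})"
    by (rule uniformity_C2_01_def)
  show "open S = (\<forall>u\<in>S. \<forall>\<^sub>F (u', v) in uniformity. u' = u \<longrightarrow> v \<in> S)" for S :: "C2_01 set"
    by (rule open_C2_01_def)
  show "u + v + w = u + (v + w)" by transfer (simp add: algebra_simps)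
  show "u + v = v + u" by transfer (simp add: algebra_simps)
  show "0 + u = u" by transfer simp
  show "- u + u = 0" by transfer simp
  show "u - v = u + - v" by transfer simp
  show "a *\<^sub>R (u + v) = a *\<^sub>R u + a *\<^sub>R v" by transfer (simp add: algebra_simps)
  show "(a + b) *\<^sub>R u = a *\<^sub>R u + b *\<^sub>R u" by transfer (simp add: algebra_simps)
  show "a *\<^sub>R b *\<^sub>R u = (a * b) *\<^sub>R u" by transfer (simp add: algebra_simps)
  show "1 *\<^sub>R u = u" by transfer simp
  show "norm (a *\<^sub>R u) = \<bar>a\<bar> * norm u" by transfer (simp add: C2_norm01_scale)
  show "norm (u + v) \<le> norm u + norm v" by transfer (simp add: C2_norm01_triangle)
  show "norm u = 0 \<longleftrightarrow> u = 0"
  proof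
    show "u = 0" if "norm u = 0"
      using that
    proof transfer
      fix u :: "real \<Rightarrow> real"
      assume u: "C2_on01 u \<and> (\<forall>t. t \<notin> {0..1} \<longrightarrow> u t = 0)" and 0: "C2_norm01 u = 0"
      have "supnorm01 u \<le> 0"
        using 0 unfolding C2_norm01_def by linarith
      then have "u t = 0" if "t \<in> {0..1}" for t
        using supnorm01_upper[OF C2_on01_continuous(1) that] u by fastforce
      then show "u = (\<lambda>t. 0)"
        using u by blast
    qed
    have "norm (0::C2_01) = 0"
      using C2_norm01_scale[OF C2_on01_0, of 0] by transfer simp
    then show "norm u = 0" if "u = 0"
      using that by simp
  qed
qed

end

definition C2_D1 :: "C2_01 \<Rightarrow> real \<Rightarrow> real"
  where "C2_D1 u = deriv01 (C2_fun u)"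

definition C2_D2 :: "C2_01 \<Rightarrow> real \<Rightarrow> real"
  where "C2_D2 u = deriv01 (deriv01 (C2_fun u))"

text \<open>
  gamma1 and gamma2 solve w''' = 0, w(0) = a, w(1) = b with zero mean on [0,1], for (a, b) = (1, 0)
  and (a, b) = (0, 1); kernel_k is the Green function of the problem
  - u''' = h, u(0) = u(1) = 0 with zero mean on [0,1].
\<close>

definition gamma1 :: "real \<Rightarrow> real"
  where "gamma1 t = 1 - 4 * t + 3 * t\<^sup>2"

definition gamma2 :: "real \<Rightarrow> real"
  where "gamma2 t = - 2 * t + 3 * t\<^sup>2"

definition kernel_k :: "real \<Rightarrow> real \<Rightarrow> real"
  where "kernel_k t s = 1 / 2 *
    (if s \<le> t then s\<^sup>2 * (1 - t) * (3 * t - 2 * t * s - 1)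
     else t * (1 - s)\<^sup>2 * (2 * t * s + t - 2 * s))"

definition Pi_box :: "real \<Rightarrow> (real \<times> real \<times> real \<times> real) set"
  where "Pi_box \<rho> = {0..1} \<times> {-\<rho>..\<rho>} \<times> {-\<rho>..\<rho>} \<times> {-\<rho>..\<rho>}"

text \<open>
  Eigenvalues of the boundary value problem
  u'''(t) + lam f(t, u(t), u'(t), u''(t)) = 0, u(0) = lam H1[u], u(1) = lam H2[u],
  with zero mean on [0,1], are understood through the perturbed Hammerstein integral equation.
\<close>

definition is_eigenpair ::
  "(real \<times> real \<times> real \<times> real \<Rightarrow> real) \<Rightarrow> (C2_01 \<Rightarrow> real) \<Rightarrow> (C2_01 \<Rightarrow> real) \<Rightarrow> real \<Rightarrow> C2_01 \<Rightarrow> bool"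
  where "is_eigenpair f H1 H2 lam u \<longleftrightarrow>
    norm u > 0 \<and>
    (\<forall>t\<in>{0..1}. C2_fun u t = lam *
      (gamma1 t * H1 u + gamma2 t * H2 u +
       integral {0..1} (\<lambda>s. kernel_k t s * f (s, C2_fun u s, C2_D1 u s, C2_D2 u s))))"

end

theory Submission
  imports Defs "HOL-Complex_Analysis.Great_Picard"
begin

text \<open>
  Write \<open>T u = \<gamma>\<^sub>1 H\<^sub>1[u] + \<gamma>\<^sub>2 H\<^sub>2[u] + \<integral> k(\<cdot>,s) f(s, u, u', u'') ds\<close>; the eigenpairs are the solutions of
  \<open>u = \<lambda> T u\<close>, and the task is to find one with \<open>\<lambda> > 0\<close> and one with \<open>\<lambda> < 0\<close> on the sphere of
  radius \<open>\<rho>\<close>. This is an instance of the Birkhoff-Kellogg theorem, and the two integral conditions say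
  exactly why it applies: as \<open>(T u)''(t) = 6 (H\<^sub>1[u] + H\<^sub>2[u]) + \<integral>\<^sub>0\<^sup>1 (1-s)\<^sup>2 (2s+1) h - \<integral>\<^sub>0\<^sup>t h\<close> with
  \<open>h(s) = f(s, u, u', u'')\<close>, the first condition together with \<open>f \<ge> \<delta>\<close>
  bounds \<open>(T u)''(0)\<close>, and the second one together with \<open>- f \<ge> \<delta>\<close> bounds \<open>(T u)''(1)\<close>, from below by a
  positive constant, uniformly on the sphere.

  Hence a bounded linear functional \<open>\<phi>\<close>, the second derivative at an end point, satisfies
  \<open>\<phi>(T u) \<ge> c > 0\<close> on the sphere. This is stronger than a lower bound for \<open>\<parallel>T u\<parallel>\<close>, and it makes the
  Birkhoff-Kellogg argument elementary (\<open>birkhoff_kellogg_functional\<close>). The general proof needs a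
  retraction of the ball of an infinite-dimensional space onto its sphere. Here, however,
  everything takes place in the half-space \<open>D = {\<phi> > 0}\<close>, which is convex and does not contain \<open>0\<close>, so that
  the radial projection \<open>r\<close> to the sphere is continuous on it. The map \<open>r \<circ> T \<circ> r\<close> sends \<open>D\<close> into a
  compact subset of \<open>D\<close>, and a fixed point of it, which Schauder's theorem provides, is a point \<open>u\<close> of the
  sphere with \<open>u = (\<rho> / \<parallel>T u\<parallel>) T u\<close>. The negative eigenvalue comes from \<open>- T\<close> and \<open>- \<phi>\<close>.

  Schauder's theorem (\<open>schauder_fixed_point\<close>) is reduced in the usual way to Brouwer's theorem in
  finite but unbounded dimension. As the dimension is a number that depends on the compact set, not a
  type, Brouwer's theorem is derived from Kuhn's combinatorial lemma for cubes in the sequence space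
  \<open>nat \<Rightarrow> real\<close> (\<open>brouwer_unit_cube\<close>).

  Compactness of \<open>T\<close> holds because \<open>T\<close> gains a derivative: \<open>(T u)''' = - h\<close> is bounded, so the second
  derivatives \<open>(T u)''\<close> have a common Lipschitz constant and the theorem of Arzela and Ascoli
  applies to them (\<open>compact_C2_01_Lipschitz\<close>).
\<close>

section \<open>Brouwer's theorem for cubes of arbitrary dimension\<close>

text \<open>
  The cube lives in the sequence space, with zeros beyond the first \<open>n\<close> coordinates, so that \<open>n\<close> may be
  any number that arises in a proof.
\<close>

definition unit_cube :: "nat \<Rightarrow> (nat \<Rightarrow> real) set"
  where "unit_cube n = (\<Pi>\<^sub>E i\<in>UNIV. if i < n then {0..1} else {0})"

lemma mem_unit_cube: "a \<in> unit_cube n \<longleftrightarrow> (\<forall>i. if i < n then 0 \<le> a i \<and> a i \<le> 1 else a i = 0)"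
  by (auto simp: unit_cube_def PiE_iff)

lemma compact_unit_cube: "compact (unit_cube n)"
proof -
  have "compactin (product_topology (\<lambda>_::nat. euclideanreal) UNIV) (unit_cube n)"
    unfolding unit_cube_def compactin_PiE by auto
  then show ?thesis
    by (simp add: euclidean_product_topology)
qed

lemma tendsto_coordinatewise:
  fixes X :: "nat \<Rightarrow> nat \<Rightarrow> real"
  assumes "\<And>i. (\<lambda>m. X m i) \<longlonglongrightarrow> a i"
  shows "X \<longlonglongrightarrow> a"
proof -
  have "limitin (product_topology (\<lambda>_::nat. euclideanreal) UNIV) X a sequentially"
    unfolding limitin_componentwise using assms by auto
  then show ?thesis
    by (simp add: euclidean_product_topology)
qed

text \<open>
  On the grid of mesh \<open>1/p\<close>, label a point in direction \<open>i\<close> according to the sign of \<open>f a i - a i\<close>. Kuhn's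
  lemma gives a cell in which both labels occur for every \<open>i < n\<close>. Along a subsequence of the cells, as
  \<open>p\<close> grows, the cells shrink to a point at which every \<open>f a i - a i\<close> is both \<open>\<ge> 0\<close> and \<open>\<le> 0\<close>.
\<close>

lemma brouwer_unit_cube:
  fixes f :: "(nat \<Rightarrow> real) \<Rightarrow> nat \<Rightarrow> real"
  assumes cont: "\<And>i. i < n \<Longrightarrow> continuous_on (unit_cube n) (\<lambda>a. f a i)"
    and range: "\<And>a i. a \<in> unit_cube n \<Longrightarrow> i < n \<Longrightarrow> 0 \<le> f a i \<and> f a i \<le> 1"
  obtains a where "a \<in> unit_cube n" "\<And>i. i < n \<Longrightarrow> f a i = a i"
proof -
  define grid :: "nat \<Rightarrow> (nat \<Rightarrow> nat) \<Rightarrow> nat \<Rightarrow> real"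
    where "grid p x i = (if i < n then real (x i) / real p else 0)" for p x i
  have grid_cube: "grid p x \<in> unit_cube n" if "p > 0" "\<And>i. i < n \<Longrightarrow> x i \<le> p" for p x
    using that by (auto simp: mem_unit_cube grid_def)
  have cell: "\<exists>q\<in>unit_cube n. \<forall>i<n. \<exists>r\<in>unit_cube n. \<exists>s\<in>unit_cube n.
      (\<forall>j. \<bar>r j - q j\<bar> \<le> 1 / real p) \<and> (\<forall>j. \<bar>s j - q j\<bar> \<le> 1 / real p) \<and>
      r i \<le> f r i \<and> f s i \<le> s i" if p: "p > 0" for p
  proof -
    define label :: "(nat \<Rightarrow> nat) \<Rightarrow> nat \<Rightarrow> nat"
      \<comment> \<open>The test \<open>x i < p\<close> forces label 1 on the far face; on the near face label 0 is automatic.\<close>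
      where "label x i = (if x i < p \<and> grid p x i \<le> f (grid p x) i then 0 else 1)" for x i
    have lab0: "grid p x i \<le> f (grid p x) i" if "label x i = 0" for x i
      using that by (auto simp: label_def split: if_splits)
    have lab1: "f (grid p x) i \<le> grid p x i"
      if "label x i \<noteq> 0" "\<And>j. j < n \<Longrightarrow> x j \<le> p" "i < n" for x i
    proof (cases "x i < p")
      case True
      then show ?thesis using that by (auto simp: label_def split: if_splits)
    next
      case False
      then have "x i = p" using that(2)[OF that(3)] by simp
      then have "grid p x i = 1" using p that(3) by (simp add: grid_def)
      then show ?thesis using range[OF grid_cube[OF p that(2)] that(3)] by simp
    qed
    obtain q where q: "\<forall>i<n. q i < p"
      and rs: "\<forall>i<n. \<exists>r s. (\<forall>j<n. q j \<le> r j \<and> r j \<le> q j + 1) \<and>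
        (\<forall>j<n. q j \<le> s j \<and> s j \<le> q j + 1) \<and> label r i \<noteq> label s i"
    proof (rule kuhn_lemma[of p n label])
      show "\<forall>x. (\<forall>i<n. x i \<le> p) \<longrightarrow> (\<forall>i<n. label x i = 0 \<or> label x i = 1)"
        by (auto simp: label_def)
      show "\<forall>x. (\<forall>i<n. x i \<le> p) \<longrightarrow> (\<forall>i<n. x i = 0 \<longrightarrow> label x i = 0)"
      proof (intro allI impI)
        fix x i assume x: "\<forall>i<n. x i \<le> p" and i: "i < n" "x i = 0"
        have "grid p x i = 0" using i by (simp add: grid_def)
        then show "label x i = 0"
          using range[OF grid_cube[OF p] i(1)] x i p by (simp add: label_def)
      qed
      show "\<forall>x. (\<forall>i<n. x i \<le> p) \<longrightarrow> (\<forall>i<n. x i = p \<longrightarrow> label x i = 1)"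
        by (auto simp: label_def)
    qed (use p in auto)
    have near: "\<bar>grid p x j - grid p q j\<bar> \<le> 1 / real p"
      if "\<forall>j<n. q j \<le> x j \<and> x j \<le> q j + 1" for x j
    proof (cases "j < n")
      case True
      then have "\<bar>real (x j) - real (q j)\<bar> \<le> 1" using that by force
      then show ?thesis using True p
        by (simp add: grid_def diff_divide_distrib[symmetric] abs_divide divide_right_mono)
    qed (use p in \<open>simp add: grid_def\<close>)
    have le_p: "x j \<le> p" if "\<forall>j<n. q j \<le> x j \<and> x j \<le> q j + 1" "j < n" for x j
      using that q by (metis Suc_eq_plus1 Suc_leI order_trans)
    show ?thesis
    proof (rule bexI[of _ "grid p q"]; (intro allI impI)?)
      show "grid p q \<in> unit_cube n" using q p by (intro grid_cube) (auto simp: less_imp_le)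
      fix i assume i: "i < n"
      obtain r s where r: "\<forall>j<n. q j \<le> r j \<and> r j \<le> q j + 1"
        and s: "\<forall>j<n. q j \<le> s j \<and> s j \<le> q j + 1" and ne: "label r i \<noteq> label s i"
        using rs i by blast
      have cubes: "grid p r \<in> unit_cube n" "grid p s \<in> unit_cube n"
        using r s le_p by (auto intro!: grid_cube p)
      consider "label r i = 0" "label s i \<noteq> 0" | "label s i = 0" "label r i \<noteq> 0"
        using ne by (auto simp: label_def split: if_splits)
      then show "\<exists>r\<in>unit_cube n. \<exists>s\<in>unit_cube n.
          (\<forall>j. \<bar>r j - grid p q j\<bar> \<le> 1 / real p) \<and> (\<forall>j. \<bar>s j - grid p q j\<bar> \<le> 1 / real p) \<and>
          r i \<le> f r i \<and> f s i \<le> s i"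
      proof cases
        case 1
        then show ?thesis
          using cubes near[OF r] near[OF s] lab0[OF 1(1)] lab1[OF 1(2) le_p[OF s] i]
          by (intro bexI[of _ "grid p r"] bexI[of _ "grid p s"] conjI allI) auto
      next
        case 2
        then show ?thesis
          using cubes near[OF r] near[OF s] lab0[OF 2(1)] lab1[OF 2(2) le_p[OF r] i]
          by (intro bexI[of _ "grid p s"] bexI[of _ "grid p r"] conjI allI) auto
      qed
    qed
  qed
  have "\<forall>m. \<exists>q\<in>unit_cube n. \<forall>i<n. \<exists>r\<in>unit_cube n. \<exists>s\<in>unit_cube n.
      (\<forall>j. \<bar>r j - q j\<bar> \<le> 1 / real (Suc m)) \<and> (\<forall>j. \<bar>s j - q j\<bar> \<le> 1 / real (Suc m)) \<and>
      r i \<le> f r i \<and> f s i \<le> s i"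
    using cell by blast
  then obtain Q where Q: "\<And>m. Q m \<in> unit_cube n"
    and Q_cell: "\<And>m i. i < n \<Longrightarrow> \<exists>r\<in>unit_cube n. \<exists>s\<in>unit_cube n.
      (\<forall>j. \<bar>r j - Q m j\<bar> \<le> 1 / real (Suc m)) \<and> (\<forall>j. \<bar>s j - Q m j\<bar> \<le> 1 / real (Suc m)) \<and>
      r i \<le> f r i \<and> f s i \<le> s i"
    by metis
  obtain a k where a: "a \<in> unit_cube n" and k: "strict_mono (k :: nat \<Rightarrow> nat)"
    and lim: "(Q \<circ> k) \<longlonglongrightarrow> a"
    using compact_unit_cube[of n] Q unfolding compact_def by metis
  have limQ: "(\<lambda>m. Q (k m) j) \<longlonglongrightarrow> a j" for j
    using continuous_on_tendsto_compose[OF continuous_on_product_coordinates[of j] lim]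
    by (simp add: o_def)
  have lim_near: "X \<longlonglongrightarrow> a" if X: "\<And>m j. \<bar>X m j - Q (k m) j\<bar> \<le> 1 / real (Suc (k m))" for X
  proof (rule tendsto_coordinatewise)
    fix j
    have "(\<lambda>m. 1 / real (Suc (k m))) \<longlonglongrightarrow> 0"
      using LIMSEQ_subseq_LIMSEQ[OF LIMSEQ_Suc[OF lim_1_over_n] k] by (simp add: o_def)
    then have "(\<lambda>m. X m j - Q (k m) j) \<longlonglongrightarrow> 0"
      by (rule Lim_null_comparison[rotated]) (use X in \<open>auto intro!: always_eventually\<close>)
    from tendsto_add[OF this limQ[of j]] show "(\<lambda>m. X m j) \<longlonglongrightarrow> a j" by simp
  qed
  have "f a i = a i" if i: "i < n" for i
  proof -
    have "\<forall>m. \<exists>r\<in>unit_cube n. (\<forall>j. \<bar>r j - Q (k m) j\<bar> \<le> 1 / real (Suc (k m))) \<and> r i \<le> f r i"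
      using Q_cell[OF i] by blast
    then obtain r where r: "\<And>m. r m \<in> unit_cube n" "\<And>m. r m i \<le> f (r m) i"
      "\<And>m j. \<bar>r m j - Q (k m) j\<bar> \<le> 1 / real (Suc (k m))"
      by metis
    have "\<forall>m. \<exists>s\<in>unit_cube n. (\<forall>j. \<bar>s j - Q (k m) j\<bar> \<le> 1 / real (Suc (k m))) \<and> f s i \<le> s i"
      using Q_cell[OF i] by blast
    then obtain s where s: "\<And>m. s m \<in> unit_cube n" "\<And>m. f (s m) i \<le> s m i"
      "\<And>m j. \<bar>s m j - Q (k m) j\<bar> \<le> 1 / real (Suc (k m))"
      by metis
    have lims: "r \<longlonglongrightarrow> a" "s \<longlonglongrightarrow> a" using r(3) s(3) by (auto intro: lim_near)
    have coord: "(\<lambda>m. x m i) \<longlonglongrightarrow> a i" if "x \<longlonglongrightarrow> a" for x :: "nat \<Rightarrow> nat \<Rightarrow> real"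
      using continuous_on_tendsto_compose[OF continuous_on_product_coordinates[of i] that] by simp
    have fc: "(\<lambda>m. f (x m) i) \<longlonglongrightarrow> f a i" if "x \<longlonglongrightarrow> a" "\<And>m. x m \<in> unit_cube n" for x
      using continuous_on_tendsto_compose[OF cont[OF i] that(1) a] that(2) by simp
    have "a i \<le> f a i"
      by (rule LIMSEQ_le[OF coord[OF lims(1)] fc[OF lims(1) r(1)]]) (use r(2) in auto)
    moreover have "f a i \<le> a i"
      by (rule LIMSEQ_le[OF fc[OF lims(2) s(1)] coord[OF lims(2)]]) (use s(2) in auto)
    ultimately show ?thesis by simp
  qed
  then show thesis using that a by blast
qed

section \<open>Schauder's theorem\<close>

text \<open>
  The Schauder projection: the points \<open>y\<^sub>i\<close> of a finite \<open>e\<close>-net of \<open>K\<close>, weighted by \<open>max 0 (e - dist x y\<^sub>i)\<close>,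
  have a barycentre that differs from \<open>x\<close> by at most \<open>e\<close>. Composing the normalised weights of \<open>G\<close> with a
  continuous map \<open>X\<close> from the unit cube to \<open>D\<close> gives a self-map of the cube. Its fixed points have
  coordinate sum 1, and \<open>X\<close> takes them to points \<open>x\<close> that are the barycentre belonging to \<open>G x\<close>.
\<close>

lemma schauder_approximate_fixed_point:
  fixes G :: "'a::real_normed_vector \<Rightarrow> 'a"
  assumes D: "convex D" "D \<noteq> {}" and cont: "continuous_on D G"
    and K: "compact K" "G ` D \<subseteq> K" "K \<subseteq> D" and e: "e > 0"
  obtains x where "x \<in> D" "norm (x - G x) \<le> e"
proof -
  obtain F where F: "finite F" "F \<subseteq> K" "K \<subseteq> (\<Union>y\<in>F. ball y e)"
  proof (rule compactE_image[OF K(1), of K "\<lambda>y. ball y e"])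
    show "K \<subseteq> (\<Union>y\<in>K. ball y e)" using e by auto
  qed auto
  obtain n :: nat and y where y: "F = y ` {i. i < n}"
    using finite_imp_nat_seg_image_inj_on[OF F(1)] by blast
  obtain z where z: "z \<in> D" using D by blast
  define w where "w i x = max 0 (e - dist x (y i))" for i x
  define W where "W x = (\<Sum>i<n. w i x)" for x
  have w0: "w i x \<ge> 0" for i x by (simp add: w_def)
  have W_pos: "W x > 0" if x: "x \<in> K" for x
  proof -
    obtain i where i: "i < n" "dist (y i) x < e" using F(3) x y by auto
    then have "w i x > 0" by (simp add: w_def dist_commute)
    then show ?thesis unfolding W_def by (intro sum_pos2[of _ i]) (use i w0 in auto)
  qed
  \<comment> \<open>A coordinate sum above 1 is scaled down to 1; mass missing to 1 is put on \<open>z\<close>.\<close>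
  define b where "b a i = a i / max 1 (\<Sum>j<n. a j)" for a :: "nat \<Rightarrow> real" and i
  define X where "X a = (\<Sum>i<n. b a i *\<^sub>R y i) + (1 - (\<Sum>i<n. b a i)) *\<^sub>R z" for a
  have y_D: "y i \<in> D" if "i < n" for i using that F(2) K(3) y by auto
  have X_D: "X a \<in> D" if a: "a \<in> unit_cube n" for a
  proof -
    have a0: "a j \<ge> 0" for j using a unfolding mem_unit_cube by (metis order_refl)
    have b0: "b a j \<ge> 0" for j using a0 by (simp add: b_def)
    have "(\<Sum>i<n. b a i) = (\<Sum>i<n. a i) / max 1 (\<Sum>j<n. a j)"
      by (simp add: b_def sum_divide_distrib)
    also have "\<dots> \<le> 1" by (simp add: divide_le_eq_1 less_max_iff_disj)
    finally have b1: "(\<Sum>i<n. b a i) \<le> 1" .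
    have "(\<Sum>i<Suc n. (if i < n then b a i else 1 - (\<Sum>i<n. b a i)) *\<^sub>R (if i < n then y i else z)) \<in> D"
      by (rule convex_sum) (use D(1) b0 b1 y_D z in auto)
    then show ?thesis by (simp add: X_def)
  qed
  have cont_b: "continuous_on A (\<lambda>a. b a i)" for A i
  proof -
    have "continuous_on A (\<lambda>a::nat \<Rightarrow> real. a j)" for j
      by (rule continuous_on_subset[OF continuous_on_product_coordinates]) simp
    then show ?thesis
      unfolding b_def by (intro continuous_on_divide continuous_on_max continuous_on_const continuous_on_sum) auto
  qed
  have cont_X: "continuous_on A X" for A
    unfolding X_def
    by (intro continuous_on_add continuous_on_sum continuous_on_scaleR continuous_on_diff continuous_on_const cont_b)
  have GX: "G (X a) \<in> K" if "a \<in> unit_cube n" for a using X_D[OF that] K by blast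
  have contGX: "continuous_on (unit_cube n) (\<lambda>a. G (X a))"
    using X_D by (intro continuous_on_compose2[OF cont cont_X]) auto
  define f where "f a i = w i (G (X a)) / W (G (X a))" for a i
  obtain a where a: "a \<in> unit_cube n" and fix_a: "\<And>i. i < n \<Longrightarrow> f a i = a i"
  proof (rule brouwer_unit_cube[of n f])
    fix i assume i: "i < n"
    show "continuous_on (unit_cube n) (\<lambda>a. f a i)"
      unfolding f_def W_def w_def
      using W_pos[OF GX]
      by (intro continuous_on_divide continuous_on_max continuous_on_const continuous_on_sum continuous_on_diff
          continuous_on_dist contGX) (force simp: W_def w_def)
    fix a assume a: "a \<in> unit_cube n"
    have "w i (G (X a)) \<le> W (G (X a))"
      unfolding W_def using i w0 by (intro member_le_sum) auto
    then show "0 \<le> f a i \<and> f a i \<le> 1"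
      unfolding f_def using W_pos[OF GX[OF a]] w0 by simp
  qed blast
  have sum1: "(\<Sum>i<n. a i) = 1"
  proof -
    have "(\<Sum>i<n. a i) = (\<Sum>i<n. f a i)" using fix_a by simp
    also have "\<dots> = 1"
      using W_pos[OF GX[OF a]] by (simp add: f_def W_def sum_divide_distrib[symmetric])
    finally show ?thesis .
  qed
  have "X a - G (X a) = (\<Sum>i<n. a i *\<^sub>R (y i - G (X a)))"
    using sum1 by (simp add: X_def b_def scaleR_diff_right sum_subtractf scaleR_left.sum[symmetric])
  also have "norm \<dots> \<le> (\<Sum>i<n. a i * e)"
  proof (rule sum_norm_le)
    fix i assume "i \<in> {..<n}"
    then have i: "i < n" by simp
    have a0: "a i \<ge> 0" using a i by (auto simp: mem_unit_cube)
    show "norm (a i *\<^sub>R (y i - G (X a))) \<le> a i * e"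
    proof (cases "dist (G (X a)) (y i) \<le> e")
      case True
      then show ?thesis using a0 by (simp add: dist_norm norm_minus_commute mult_left_mono)
    next
      case False
      then have "a i = 0" using fix_a[OF i] by (simp add: f_def w_def)
      then show ?thesis by simp
    qed
  qed
  also have "\<dots> = e" using sum1 by (simp add: sum_distrib_right[symmetric])
  finally show thesis using that X_D[OF a] by blast
qed

theorem schauder_fixed_point:
  fixes G :: "'a::real_normed_vector \<Rightarrow> 'a"
  assumes D: "convex D" "D \<noteq> {}" and cont: "continuous_on D G"
    and K: "compact K" "G ` D \<subseteq> K" "K \<subseteq> D"
  obtains x where "x \<in> D" "G x = x"
proof -
  have "\<exists>x\<in>D. norm (x - G x) \<le> 1 / real (Suc m)" for m
    using schauder_approximate_fixed_point[OF D cont K, of "1 / real (Suc m)"] by force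
  then obtain x where x: "\<And>m. x m \<in> D" "\<And>m. norm (x m - G (x m)) \<le> 1 / real (Suc m)"
    by metis
  have "\<And>m. (G \<circ> x) m \<in> K" using x(1) K(2) by auto
  then obtain y k where y: "y \<in> K" and k: "strict_mono (k :: nat \<Rightarrow> nat)"
    and lim: "((G \<circ> x) \<circ> k) \<longlonglongrightarrow> y"
    using K(1) unfolding compact_def by metis
  have "(\<lambda>m. 1 / real (Suc (k m))) \<longlonglongrightarrow> 0"
    using LIMSEQ_subseq_LIMSEQ[OF LIMSEQ_Suc[OF lim_1_over_n] k] by (simp add: o_def)
  then have "(\<lambda>m. x (k m) - G (x (k m))) \<longlonglongrightarrow> 0"
    by (rule Lim_null_comparison[rotated]) (use x(2) in \<open>auto intro!: always_eventually\<close>)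
  from tendsto_add[OF this lim] have xlim: "(\<lambda>m. x (k m)) \<longlonglongrightarrow> y" by (simp add: o_def)
  have "(\<lambda>m. G (x (k m))) \<longlonglongrightarrow> G y"
    using continuous_on_tendsto_compose[OF cont xlim] y K(3) x(1) by auto
  then have "G y = y" using lim LIMSEQ_unique by (auto simp: o_def)
  then show thesis using that y K(3) by blast
qed

section \<open>The Birkhoff-Kellogg theorem with a positive functional\<close>

text \<open>
  The functional confines the problem to the open half-space \<open>D\<close>, on which the radial projection \<open>r\<close> is
  continuous and which \<open>r\<close> maps into itself. Since \<open>T\<close> sends the sphere into the compact set
  \<open>K' = K \<inter> {c \<le> \<phi>}\<close>, the map \<open>r \<circ> T \<circ> r\<close> sends \<open>D\<close> into the compact set \<open>r ` K'\<close>, which lies in \<open>D\<close>.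
\<close>

theorem birkhoff_kellogg_functional:
  fixes T :: "'a::real_normed_vector \<Rightarrow> 'a" and \<phi> :: "'a \<Rightarrow> real"
  assumes rho: "\<rho> > 0" and ne: "sphere (0::'a) \<rho> \<noteq> {}"
    and cont: "continuous_on (sphere 0 \<rho>) T"
    and K: "compact K" "T ` sphere 0 \<rho> \<subseteq> K"
    and phi: "bounded_linear \<phi>" and c: "c > 0"
    and low: "\<And>u. u \<in> sphere 0 \<rho> \<Longrightarrow> c \<le> \<phi> (T u)"
  obtains lam u where "lam > 0" "u \<in> sphere 0 \<rho>" "u = lam *\<^sub>R T u"
proof -
  interpret phi: bounded_linear \<phi> by (rule phi)
  define D where "D = {x. 0 < \<phi> x}"
  define r where "r x = (\<rho> / norm x) *\<^sub>R x" for x :: 'a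
  have D0: "x \<noteq> 0" if "x \<in> D" for x using that by (auto simp: D_def phi.zero)
  have r_sphere: "r x \<in> sphere 0 \<rho>" if "x \<noteq> 0" for x
    using that rho by (simp add: r_def)
  have cont_r: "continuous_on A r" if "0 \<notin> A" for A
    unfolding r_def using that by (intro continuous_intros) auto
  have r_D: "r x \<in> D" if "x \<in> D" for x
    using that D0[OF that] rho by (simp add: r_def D_def phi.scaleR)
  define K' where "K' = K \<inter> {x. c \<le> \<phi> x}"
  have K'_D: "K' \<subseteq> D" using c by (auto simp: K'_def D_def)
  have K'0: "0 \<notin> K'" using K'_D D0 by blast
  have "closed {x. c \<le> \<phi> x}"
    by (intro closed_Collect_le continuous_intros phi.continuous_on)
  then have "compact K'" unfolding K'_def using K(1) by (rule compact_Int_closed[rotated])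
  then have compact: "compact (r ` K')"
    by (intro compact_continuous_image cont_r K'0)
  have T_K': "T u \<in> K'" if "u \<in> sphere 0 \<rho>" for u
    using K(2) low[OF that] that by (auto simp: K'_def)
  have "convex D"
    unfolding convex_def D_def
  proof (intro ballI allI impI, simp add: phi.add phi.scaleR)
    fix x y and s t :: real
    assume xy: "0 < \<phi> x" "0 < \<phi> y" and st: "0 \<le> s" "0 \<le> t" "s + t = 1"
    show "0 < s * \<phi> x + t * \<phi> y"
    proof (cases "s = 0")
      case False
      then have "0 < s * \<phi> x" using xy st by simp
      then show ?thesis using xy st by (simp add: add_pos_nonneg)
    qed (use xy st in simp)
  qed
  moreover have "D \<noteq> {}"
    using ne T_K' K'_D by blast
  moreover have "continuous_on D (\<lambda>x. r (T (r x)))"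
  proof -
    have "continuous_on D r" using D0 by (intro cont_r) blast
    moreover have "r ` D \<subseteq> sphere 0 \<rho>" using r_sphere D0 by blast
    ultimately have "continuous_on D (\<lambda>x. T (r x))"
      using continuous_on_compose2[OF cont] by blast
    moreover have "(\<lambda>x. T (r x)) ` D \<subseteq> K'" using r_sphere D0 T_K' by blast
    ultimately show ?thesis
      using continuous_on_compose2[OF cont_r[OF K'0]] by blast
  qed
  moreover have "(\<lambda>x. r (T (r x))) ` D \<subseteq> r ` K'" using r_sphere D0 T_K' by blast
  moreover have "r ` K' \<subseteq> D" using K'_D r_D by blast
  ultimately obtain x where x: "x \<in> D" "r (T (r x)) = x"
    using schauder_fixed_point[of D "\<lambda>x. r (T (r x))" "r ` K'"] compact by blast
  have Tr: "T (r x) \<noteq> 0" using T_K'[OF r_sphere[OF D0[OF x(1)]]] K'0 by metis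
  \<comment> \<open>The fixed point is a value of \<open>r\<close>, hence lies on the sphere, where \<open>r\<close> is the identity.\<close>
  have sph: "x \<in> sphere 0 \<rho>" using r_sphere[OF Tr] x(2) by simp
  then have "r x = x" using rho by (simp add: r_def)
  then have "x = (\<rho> / norm (T x)) *\<^sub>R T x" "T x \<noteq> 0" using x(2) Tr by (auto simp: r_def)
  then show thesis using that[of "\<rho> / norm (T x)" x] sph rho by simp
qed

corollary birkhoff_kellogg_functional_both_signs:
  fixes T :: "'a::real_normed_vector \<Rightarrow> 'a" and \<phi> :: "'a \<Rightarrow> real"
  assumes rho: "\<rho> > 0" and ne: "sphere (0::'a) \<rho> \<noteq> {}"
    and cont: "continuous_on (sphere 0 \<rho>) T"
    and K: "compact K" "T ` sphere 0 \<rho> \<subseteq> K"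
    and phi: "bounded_linear \<phi>" and c: "c > 0"
    and low: "\<And>u. u \<in> sphere 0 \<rho> \<Longrightarrow> c \<le> \<phi> (T u)"
  shows "(\<exists>lam u. lam > 0 \<and> u \<in> sphere 0 \<rho> \<and> u = lam *\<^sub>R T u) \<and>
         (\<exists>lam u. lam < 0 \<and> u \<in> sphere 0 \<rho> \<and> u = lam *\<^sub>R T u)"
proof
  show "\<exists>lam u. lam > 0 \<and> u \<in> sphere 0 \<rho> \<and> u = lam *\<^sub>R T u"
    using birkhoff_kellogg_functional[OF assms] by metis
  have "compact (uminus ` K)" "(\<lambda>u. - T u) ` sphere 0 \<rho> \<subseteq> uminus ` K"
    using K by (auto intro: compact_negations)
  moreover have "c \<le> - \<phi> (- T u)" if "u \<in> sphere 0 \<rho>" for u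
    using low[OF that] by (simp add: linear_neg[OF bounded_linear.linear[OF phi]])
  ultimately obtain lam u where "lam > 0" "u \<in> sphere 0 \<rho>" "u = lam *\<^sub>R (- T u)"
    using birkhoff_kellogg_functional[OF rho ne continuous_on_minus[OF cont] _ _
        bounded_linear_minus[OF phi] c] by metis
  then show "\<exists>lam u. lam < 0 \<and> u \<in> sphere 0 \<rho> \<and> u = lam *\<^sub>R T u"
    by (intro exI[of _ "- lam"] exI[of _ u]) simp
qed

section \<open>Functions of class \<open>C\<^sup>2\<close> and their jets\<close>

lemma C2_01_derivs:
  assumes t: "t \<in> {0..1}"
  shows "(C2_fun u has_real_derivative C2_D1 u t) (at t within {0..1})"
    and "(C2_D1 u has_real_derivative C2_D2 u t) (at t within {0..1})"
    and "continuous_on {0..1} (C2_fun u)" "continuous_on {0..1} (C2_D1 u)"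
    "continuous_on {0..1} (C2_D2 u)"
proof -
  have u: "C2_on01 (C2_fun u)" using C2_fun[of u] by simp
  show "(C2_fun u has_real_derivative C2_D1 u t) (at t within {0..1})"
    using deriv01_works[OF _ t, of "C2_fun u"] u
    by (simp add: C2_on01_def C2_D1_def has_real_derivative_iff_has_vector_derivative)
  show "(C2_D1 u has_real_derivative C2_D2 u t) (at t within {0..1})"
    using deriv01_works[OF _ t, of "deriv01 (C2_fun u)"] u
    unfolding C2_D1_def C2_D2_def
    by (simp add: C2_on01_def has_real_derivative_iff_has_vector_derivative)
  show "continuous_on {0..1} (C2_fun u)" "continuous_on {0..1} (C2_D1 u)"
    "continuous_on {0..1} (C2_D2 u)"
    using C2_on01_continuous[OF u] by (simp_all add: C2_D1_def[abs_def] C2_D2_def[abs_def])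
qed

lemma C2_01_eqI:
  assumes "\<And>t. t \<in> {0..1} \<Longrightarrow> C2_fun u t = C2_fun v t"
  shows "u = v"
proof -
  have "C2_fun u = C2_fun v"
  proof
    fix t show "C2_fun u t = C2_fun v t"
      using assms[of t] C2_fun[of u] C2_fun[of v] by (cases "t \<in> {0..1}") auto
  qed
  then show ?thesis by (simp add: C2_fun_inject)
qed

lemma C2_01_unique_derivs:
  assumes u: "\<And>t. t \<in> {0..1} \<Longrightarrow> C2_fun v t = u t"
    and d1: "\<And>t. t \<in> {0..1} \<Longrightarrow> (u has_real_derivative u' t) (at t within {0..1})"
    and d2: "\<And>t. t \<in> {0..1} \<Longrightarrow> (u' has_real_derivative u'' t) (at t within {0..1})"
    and t: "t \<in> {0..1}"
  shows "C2_D1 v t = u' t" "C2_D2 v t = u'' t"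
proof -
  have D1: "C2_D1 v t = u' t" if t: "t \<in> {0..1}" for t
    unfolding C2_D1_def
    by (rule deriv01_unique[OF has_vector_derivative_transform[OF t u] t])
      (use d1[OF t] in \<open>auto simp: has_real_derivative_iff_has_vector_derivative\<close>)
  show "C2_D1 v t = u' t" by (rule D1[OF t])
  have "deriv01 (C2_D1 v) t = u'' t"
    by (rule deriv01_unique[OF has_vector_derivative_transform[OF t D1] t])
      (use d2[OF t] in \<open>auto simp: has_real_derivative_iff_has_vector_derivative\<close>)
  then show "C2_D2 v t = u'' t" by (simp add: C2_D1_def[abs_def] C2_D2_def)
qed

definition C2_of :: "(real \<Rightarrow> real) \<Rightarrow> C2_01"
  where "C2_of u = C2_Abs (\<lambda>t. if t \<in> {0..1} then u t else 0)"

lemma C2_fun_C2_of: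
  assumes d1: "\<And>t. t \<in> {0..1} \<Longrightarrow> (u has_real_derivative u' t) (at t within {0..1})"
    and d2: "\<And>t. t \<in> {0..1} \<Longrightarrow> (u' has_real_derivative u'' t) (at t within {0..1})"
    and cont: "continuous_on {0..1} u''" and t: "t \<in> {0..1}"
  shows "C2_fun (C2_of u) t = u t"
proof -
  define w where "w t = (if t \<in> {0..1} then u t else 0)" for t
  have w1: "(w has_vector_derivative u' t) (at t within {0..1})" if t: "t \<in> {0..1}" for t
    by (rule has_vector_derivative_transform[OF t])
      (use d1[OF t] in \<open>auto simp: w_def has_real_derivative_iff_has_vector_derivative\<close>)
  have D1: "deriv01 w t = u' t" if "t \<in> {0..1}" for t
    using deriv01_unique[OF w1] that by blast
  have w2: "(deriv01 w has_vector_derivative u'' t) (at t within {0..1})" if t: "t \<in> {0..1}" for t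
    by (rule has_vector_derivative_transform[OF t D1])
      (use d2[OF t] in \<open>auto simp: has_real_derivative_iff_has_vector_derivative\<close>)
  have D2: "deriv01 (deriv01 w) t = u'' t" if "t \<in> {0..1}" for t
    using deriv01_unique[OF w2] that by blast
  have "continuous_on {0..1} (deriv01 (deriv01 w))"
    using cont D2 continuous_on_cong by (metis (no_types, lifting))
  then have "C2_on01 w"
    unfolding C2_on01_def differentiable_on_def using w1 w2 differentiableI_vector by blast
  then have "C2_fun (C2_Abs w) = w"
    by (intro C2_Abs_inverse) (auto simp: w_def)
  moreover have "C2_of u = C2_Abs w" by (simp add: C2_of_def w_def[abs_def])
  ultimately show ?thesis using t by (simp add: w_def)
qed

lemma C2_01_bounds:
  assumes t: "t \<in> {0..1}"
  shows "\<bar>C2_fun u t\<bar> \<le> norm u" "\<bar>C2_D1 u t\<bar> \<le> norm u" "\<bar>C2_D2 u t\<bar> \<le> norm u"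
proof -
  have n: "norm u = C2_norm01 (C2_fun u)" by (simp add: norm_C2_01.rep_eq)
  note c = C2_01_derivs(3-5)[OF t, of u]
  note s = supnorm01_upper[OF c(1) t] supnorm01_upper[OF c(2) t] supnorm01_upper[OF c(3) t]
  show "\<bar>C2_fun u t\<bar> \<le> norm u" "\<bar>C2_D1 u t\<bar> \<le> norm u" "\<bar>C2_D2 u t\<bar> \<le> norm u"
    using s unfolding n C2_norm01_def C2_D1_def[abs_def] C2_D2_def[abs_def] by linarith+
qed

lemma C2_01_lincomb:
  assumes t: "t \<in> {0..1}"
  shows "C2_fun (a *\<^sub>R u + b *\<^sub>R v) t = a * C2_fun u t + b * C2_fun v t"
    and "C2_D1 (a *\<^sub>R u + b *\<^sub>R v) t = a * C2_D1 u t + b * C2_D1 v t"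
    and "C2_D2 (a *\<^sub>R u + b *\<^sub>R v) t = a * C2_D2 u t + b * C2_D2 v t"
proof -
  have eq: "C2_fun (a *\<^sub>R u + b *\<^sub>R v) t = a * C2_fun u t + b * C2_fun v t" for t
    by (simp add: plus_C2_01.rep_eq scaleR_C2_01.rep_eq)
  then show "C2_fun (a *\<^sub>R u + b *\<^sub>R v) t = a * C2_fun u t + b * C2_fun v t" .
  show "C2_D1 (a *\<^sub>R u + b *\<^sub>R v) t = a * C2_D1 u t + b * C2_D1 v t"
    and "C2_D2 (a *\<^sub>R u + b *\<^sub>R v) t = a * C2_D2 u t + b * C2_D2 v t"
    by (rule C2_01_unique_derivs[where u'' = "\<lambda>t. a * C2_D2 u t + b * C2_D2 v t" and
          u' = "\<lambda>t. a * C2_D1 u t + b * C2_D1 v t" and u = "\<lambda>t. a * C2_fun u t + b * C2_fun v t"];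
        (intro DERIV_add DERIV_cmult C2_01_derivs t eq)?; assumption?)+
qed

lemma C2_01_diff:
  assumes t: "t \<in> {0..1}"
  shows "C2_fun (u - v) t = C2_fun u t - C2_fun v t"
    and "C2_D1 (u - v) t = C2_D1 u t - C2_D1 v t"
    and "C2_D2 (u - v) t = C2_D2 u t - C2_D2 v t"
  using C2_01_lincomb[OF t, of 1 u "-1" v] by simp_all

lemma bounded_linear_C2_D2:
  assumes "t \<in> {0..1}"
  shows "bounded_linear (\<lambda>u. C2_D2 u t)"
proof (rule bounded_linear_intro)
  show "C2_D2 (u + v) t = C2_D2 u t + C2_D2 v t" for u v
    using C2_01_lincomb(3)[OF assms, of 1 u 1 v] by simp
  show "C2_D2 (r *\<^sub>R u) t = r *\<^sub>R C2_D2 u t" for r u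
    using C2_01_lincomb(3)[OF assms, of r u 0 u] by simp
  show "norm (C2_D2 u t) \<le> norm u * 1" for u
    using C2_01_bounds(3)[OF assms] by simp
qed

text \<open>
  By the mean value theorem, the norm is controlled by the initial data and the second derivative.
  Estimates and limits in \<open>C\<^sup>2\<close> thereby reduce to uniform ones for the second derivative.
\<close>

lemma C2_01_norm_le:
  assumes D2: "\<And>t. t \<in> {0..1} \<Longrightarrow> \<bar>C2_D2 u t\<bar> \<le> c"
  shows "norm u \<le> \<bar>C2_fun u 0\<bar> + \<bar>C2_D1 u 0\<bar> + c"
proof -
  have c: "0 \<le> c" using D2[of 0] by simp
  have growth: "\<bar>g t\<bar> \<le> \<bar>g 0\<bar> + B"
    if d: "\<And>t. t \<in> {0..1} \<Longrightarrow> (g has_real_derivative g' t) (at t within {0..1})"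
      and B: "\<And>t. t \<in> {0..1} \<Longrightarrow> \<bar>g' t\<bar> \<le> B" and t: "t \<in> {0..1}"
    for g g' :: "real \<Rightarrow> real" and B t
  proof -
    have "norm (g t - g 0) \<le> B * norm (t - 0)"
      by (rule field_differentiable_bound[of "{0..1}" g g']) (use d B t in auto)
    also have "\<dots> \<le> B" using t B[of 0] by (simp add: mult_left_le)
    finally show ?thesis by simp
  qed
  have D1: "\<bar>C2_D1 u t\<bar> \<le> \<bar>C2_D1 u 0\<bar> + c" if "t \<in> {0..1}" for t
    by (rule growth[OF C2_01_derivs(2) D2 that])
  have D0: "\<bar>C2_fun u t\<bar> \<le> \<bar>C2_fun u 0\<bar> + (\<bar>C2_D1 u 0\<bar> + c)" if "t \<in> {0..1}" for t
    by (rule growth[OF C2_01_derivs(1) D1 that])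
  have "supnorm01 (C2_fun u) \<le> \<bar>C2_fun u 0\<bar> + \<bar>C2_D1 u 0\<bar> + c"
    using D0 by (intro supnorm01_least) fastforce
  moreover have "supnorm01 (C2_D1 u) \<le> \<bar>C2_fun u 0\<bar> + \<bar>C2_D1 u 0\<bar> + c"
    using D1 by (intro supnorm01_least) fastforce
  moreover have "supnorm01 (C2_D2 u) \<le> \<bar>C2_fun u 0\<bar> + \<bar>C2_D1 u 0\<bar> + c"
    using D2 by (intro supnorm01_least) fastforce
  ultimately show ?thesis
    by (simp add: norm_C2_01.rep_eq C2_norm01_def C2_D1_def[abs_def] C2_D2_def[abs_def])
qed

lemma C2_01_prescribed:
  fixes p q :: real
  assumes g: "continuous_on {0..1} g"
  obtains v where "C2_fun v 0 = p" "C2_D1 v 0 = q" "\<And>t. t \<in> {0..1} \<Longrightarrow> C2_D2 v t = g t"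
proof -
  define u' where "u' t = q + integral {0..t} g" for t
  define u where "u t = p + integral {0..t} u'" for t
  have d2: "(u' has_real_derivative g t) (at t within {0..1})" if "t \<in> {0..1}" for t
    unfolding u'_def
    using DERIV_add[OF DERIV_const integral_has_real_derivative[OF g that]] by simp
  have "continuous_on {0..1} u'"
    using d2 by (rule DERIV_continuous_on)
  then have d1: "(u has_real_derivative u' t) (at t within {0..1})" if "t \<in> {0..1}" for t
    unfolding u_def
    using DERIV_add[OF DERIV_const integral_has_real_derivative[OF _ that]] by simp
  have v: "C2_fun (C2_of u) t = u t" if "t \<in> {0..1}" for t
    by (rule C2_fun_C2_of[OF d1 d2 g that])
  note D = C2_01_unique_derivs[OF v d1 d2]
  show thesis
    using that[of "C2_of u"] v[of 0] D[of 0] D(2) by (simp add: u_def u'_def)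
qed

section \<open>Compactness in \<open>C\<^sup>2\<close>\<close>

text \<open>
  Arzela-Ascoli applies to the sequence of triples \<open>(u\<^sub>n(0), u\<^sub>n'(0), u\<^sub>n''(t))\<close>, in which the first two
  components are constant in \<open>t\<close>: one extraction makes the initial data and the second derivatives
  converge together. The limit in \<open>C\<^sup>2\<close> is the function with the limiting data.
\<close>

lemma compact_C2_01_Lipschitz:
  "compact {u. \<bar>C2_fun u 0\<bar> \<le> M \<and> \<bar>C2_D1 u 0\<bar> \<le> M \<and> (\<forall>t\<in>{0..1}. \<bar>C2_D2 u t\<bar> \<le> M) \<and>
    (\<forall>s\<in>{0..1}. \<forall>t\<in>{0..1}. \<bar>C2_D2 u s - C2_D2 u t\<bar> \<le> M * \<bar>s - t\<bar>)}" (is "compact ?K")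
  unfolding compact_def
proof (intro allI impI)
  fix U :: "nat \<Rightarrow> C2_01" assume "\<forall>n. U n \<in> ?K"
  then have U0: "\<bar>C2_fun (U n) 0\<bar> \<le> M" and U1: "\<bar>C2_D1 (U n) 0\<bar> \<le> M"
    and U2: "\<And>t. t \<in> {0..1} \<Longrightarrow> \<bar>C2_D2 (U n) t\<bar> \<le> M"
    and UL: "\<And>s t. s \<in> {0..1} \<Longrightarrow> t \<in> {0..1} \<Longrightarrow> \<bar>C2_D2 (U n) s - C2_D2 (U n) t\<bar> \<le> M * \<bar>s - t\<bar>"
    for n
    by blast+
  have M: "0 \<le> M" using U0[of 0] by simp
  define F where "F n t = (C2_fun (U n) 0, C2_D1 (U n) 0, C2_D2 (U n) t)" for n t
  obtain g and k :: "nat \<Rightarrow> nat" where g: "continuous_on {0..1} g" and k: "strict_mono k"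
    and lim: "\<And>e. 0 < e \<Longrightarrow> \<exists>N. \<forall>n t. n \<ge> N \<and> t \<in> {0..1} \<longrightarrow> norm (F (k n) t - g t) < e"
  proof (rule Arzela_Ascoli[of "{0..1::real}" F "M + (M + M)"])
    show "norm (F n t) \<le> M + (M + M)" if "t \<in> {0..1}" for n t
      unfolding F_def
      using norm_Pair_le[of "C2_fun (U n) 0" "(C2_D1 (U n) 0, C2_D2 (U n) t)"]
        norm_Pair_le[of "C2_D1 (U n) 0" "C2_D2 (U n) t"] U0[of n] U1[of n] U2[OF that, of n]
      by simp
    show "\<exists>d>0. \<forall>n t. t \<in> {0..1} \<and> norm (s - t) < d \<longrightarrow> norm (F n s - F n t) < e"
      if s: "s \<in> {0..1}" and e: "0 < e" for s e
    proof (intro exI[of _ "e / (M + 1)"] conjI allI impI)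
      show "0 < e / (M + 1)" using e M by simp
      fix n t assume t: "t \<in> {0..1} \<and> norm (s - t) < e / (M + 1)"
      have "norm (F n s - F n t) = \<bar>C2_D2 (U n) s - C2_D2 (U n) t\<bar>"
        by (simp add: F_def)
      also have "\<dots> \<le> M * \<bar>s - t\<bar>" using UL s t by blast
      also have "\<dots> \<le> (M + 1) * \<bar>s - t\<bar>" by (simp add: algebra_simps)
      also have "\<dots> < e" using t M by (simp add: pos_less_divide_eq mult.commute)
      finally show "norm (F n s - F n t) < e" .
    qed
  qed auto
  obtain v where v0: "C2_fun v 0 = fst (g 0)" and v1: "C2_D1 v 0 = fst (snd (g 0))"
    and v2: "\<And>t. t \<in> {0..1} \<Longrightarrow> C2_D2 v t = snd (snd (g t))"
    using C2_01_prescribed[of "\<lambda>t. snd (snd (g t))" "fst (g 0)" "fst (snd (g 0))"] g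
    by (metis continuous_on_snd)
  have comp: "\<bar>C2_fun (U n) 0 - fst (g t)\<bar> \<le> norm (F n t - g t)"
    "\<bar>C2_D1 (U n) 0 - fst (snd (g t))\<bar> \<le> norm (F n t - g t)"
    "\<bar>C2_D2 (U n) t - snd (snd (g t))\<bar> \<le> norm (F n t - g t)" for n t
  proof -
    have proj: "\<bar>fst z\<bar> \<le> norm z" "\<bar>fst (snd z)\<bar> \<le> norm z" "\<bar>snd (snd z)\<bar> \<le> norm z"
      for z :: "real \<times> real \<times> real"
      using norm_fst_le[of "fst z" "snd z"] norm_snd_le[of "snd z" "fst z"]
        norm_fst_le[of "fst (snd z)" "snd (snd z)"] norm_snd_le[of "snd (snd z)" "fst (snd z)"]
      by auto
    show "\<bar>C2_fun (U n) 0 - fst (g t)\<bar> \<le> norm (F n t - g t)"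
      "\<bar>C2_D1 (U n) 0 - fst (snd (g t))\<bar> \<le> norm (F n t - g t)"
      "\<bar>C2_D2 (U n) t - snd (snd (g t))\<bar> \<le> norm (F n t - g t)"
      using proj[of "F n t - g t"] by (simp_all add: F_def)
  qed
  have conv: "(U \<circ> k) \<longlonglongrightarrow> v"
  proof (rule metric_LIMSEQ_I)
    fix e :: real assume e: "e > 0"
    obtain N where N: "\<And>n t. n \<ge> N \<Longrightarrow> t \<in> {0..1} \<Longrightarrow> norm (F (k n) t - g t) < e / 4"
      using lim[of "e / 4"] e by auto
    show "\<exists>N. \<forall>n\<ge>N. dist ((U \<circ> k) n) v < e"
    proof (intro exI allI impI)
      fix n assume n: "N \<le> n"
      have "norm (U (k n) - v) \<le> \<bar>C2_fun (U (k n) - v) 0\<bar> + \<bar>C2_D1 (U (k n) - v) 0\<bar> + e / 4"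
      proof (rule C2_01_norm_le)
        fix t :: real assume t: "t \<in> {0..1}"
        show "\<bar>C2_D2 (U (k n) - v) t\<bar> \<le> e / 4"
          using comp(3)[of "k n" t] N[OF n t] v2[OF t] C2_01_diff(3)[OF t, of "U (k n)" v] by simp
      qed
      also have "\<dots> \<le> e / 4 + e / 4 + e / 4"
        using comp(1,2)[of "k n" 0] N[OF n, of 0] v0 v1 C2_01_diff[of 0 "U (k n)" v] by simp
      finally show "dist ((U \<circ> k) n) v < e" using e by (simp add: dist_norm)
    qed
  qed
  have lims: "(\<lambda>n. C2_fun (U (k n)) t) \<longlonglongrightarrow> C2_fun v t" "(\<lambda>n. C2_D1 (U (k n)) t) \<longlonglongrightarrow> C2_D1 v t"
    "(\<lambda>n. C2_D2 (U (k n)) t) \<longlonglongrightarrow> C2_D2 v t" if t: "t \<in> {0..1}" for t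
  proof -
    have null: "(\<lambda>n. norm (U (k n) - v)) \<longlonglongrightarrow> 0"
      using conv by (simp add: o_def LIM_zero tendsto_norm_zero)
    show "(\<lambda>n. C2_fun (U (k n)) t) \<longlonglongrightarrow> C2_fun v t" "(\<lambda>n. C2_D1 (U (k n)) t) \<longlonglongrightarrow> C2_D1 v t"
      "(\<lambda>n. C2_D2 (U (k n)) t) \<longlonglongrightarrow> C2_D2 v t"
      using C2_01_bounds[OF t, of "U (k n) - v" for n]
      by (auto intro!: LIM_zero_cancel[OF Lim_null_comparison[OF always_eventually null]]
          simp: C2_01_diff[OF t])
  qed
  have "v \<in> ?K"
  proof (intro CollectI conjI ballI)
    show "\<bar>C2_fun v 0\<bar> \<le> M"
      by (rule LIMSEQ_le_const2[OF tendsto_rabs[OF lims(1)]]) (use U0 in auto)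
    show "\<bar>C2_D1 v 0\<bar> \<le> M"
      by (rule LIMSEQ_le_const2[OF tendsto_rabs[OF lims(2)]]) (use U1 in auto)
    fix t :: real assume t: "t \<in> {0..1}"
    show "\<bar>C2_D2 v t\<bar> \<le> M"
      by (rule LIMSEQ_le_const2[OF tendsto_rabs[OF lims(3)[OF t]]]) (use U2[OF t] in auto)
    fix s :: real assume s: "s \<in> {0..1}"
    show "\<bar>C2_D2 v t - C2_D2 v s\<bar> \<le> M * \<bar>t - s\<bar>"
      by (rule LIMSEQ_le_const2[OF tendsto_rabs[OF tendsto_diff[OF lims(3)[OF t] lims(3)[OF s]]]])
        (use UL[OF t s] in auto)
  qed
  then show "\<exists>l\<in>?K. \<exists>r. strict_mono (r :: nat \<Rightarrow> nat) \<and> (U \<circ> r) \<longlonglongrightarrow> l"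
    using k conv by blast
qed

section \<open>The linear Hammerstein operator\<close>

text \<open>
  The perturbed Hammerstein operator as a linear function of its data: \<open>a\<close> and \<open>b\<close> stand for the
  values of \<open>H\<^sub>1\<close> and \<open>H\<^sub>2\<close>, and \<open>h\<close> for \<open>s \<mapsto> f(s, u(s), u'(s), u''(s))\<close>.
\<close>

definition hammerstein :: "real \<Rightarrow> real \<Rightarrow> (real \<Rightarrow> real) \<Rightarrow> C2_01"
  where "hammerstein a b h =
    C2_of (\<lambda>t. gamma1 t * a + gamma2 t * b + integral {0..1} (\<lambda>s. kernel_k t s * h s))"

text \<open>
  The part \<open>- (t - s)\<^sub>+\<^sup>2 / 2\<close> is the fundamental solution of \<open>- u''' = h\<close>; the remainder is a polynomial in \<open>t\<close>
  of degree 2. This form shows that the kernel is continuous and makes it easy to differentiate the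
  integral with respect to \<open>t\<close>.
\<close>

lemma kernel_k_eq:
  "kernel_k t s = t\<^sup>2 / 2 * ((1 - s)\<^sup>2 * (2 * s + 1)) - t * (s * (1 - s)\<^sup>2) - (max 0 (t - s))\<^sup>2 / 2"
  by (auto simp: kernel_k_def max_def field_simps power2_eq_square)

text \<open>
  Expanding the square moves the parameter \<open>t\<close> out of the integrands, so that only the upper limits
  depend on it and the fundamental theorem of calculus gives the derivatives.
\<close>

lemma integral_max_square:
  fixes h :: "real \<Rightarrow> real"
  assumes h: "continuous_on {0..1} h" and t: "t \<in> {0..1}"
  shows "integral {0..1} (\<lambda>s. (max 0 (t - s))\<^sup>2 * h s)
    = t\<^sup>2 * integral {0..t} h - 2 * t * integral {0..t} (\<lambda>s. s * h s) + integral {0..t} (\<lambda>s. s\<^sup>2 * h s)"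
proof -
  have ht: "continuous_on {0..t} h" using continuous_on_subset[OF h] t by auto
  have int: "(\<lambda>s. (max 0 (t - s))\<^sup>2 * h s) integrable_on {0..1}"
    by (intro integrable_continuous_interval continuous_intros h)
  have "integral {t..1} (\<lambda>s. (max 0 (t - s))\<^sup>2 * h s) = integral {t..1} (\<lambda>s. 0)"
    by (intro integral_cong) auto
  then have "integral {0..1} (\<lambda>s. (max 0 (t - s))\<^sup>2 * h s) = integral {0..t} (\<lambda>s. (max 0 (t - s))\<^sup>2 * h s)"
    using Henstock_Kurzweil_Integration.integral_combine[OF _ _ int, of t] t by simp
  also have "\<dots> = integral {0..t} (\<lambda>s. t\<^sup>2 * h s - 2 * t * (s * h s) + s\<^sup>2 * h s)"
    by (intro integral_cong) (auto simp: algebra_simps power2_eq_square)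
  also have "\<dots> = integral {0..t} (\<lambda>s. t\<^sup>2 * h s) - integral {0..t} (\<lambda>s. 2 * t * (s * h s))
      + integral {0..t} (\<lambda>s. s\<^sup>2 * h s)"
  proof -
    have "(\<lambda>s. t\<^sup>2 * h s) integrable_on {0..t}" "(\<lambda>s. 2 * t * (s * h s)) integrable_on {0..t}"
      "(\<lambda>s. s\<^sup>2 * h s) integrable_on {0..t}"
      by (intro integrable_continuous_interval continuous_intros ht)+
    then show ?thesis
      by (simp only: Henstock_Kurzweil_Integration.integral_add Henstock_Kurzweil_Integration.integral_diff integrable_diff)
  qed
  finally show ?thesis by simp
qed

lemma integral_kernel_k:
  fixes h :: "real \<Rightarrow> real"
  assumes h: "continuous_on {0..1} h" and t: "t \<in> {0..1}"
  shows "integral {0..1} (\<lambda>s. kernel_k t s * h s)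
    = t\<^sup>2 / 2 * integral {0..1} (\<lambda>s. (1 - s)\<^sup>2 * (2 * s + 1) * h s)
      - t * integral {0..1} (\<lambda>s. s * (1 - s)\<^sup>2 * h s)
      - (t\<^sup>2 * integral {0..t} h - 2 * t * integral {0..t} (\<lambda>s. s * h s) + integral {0..t} (\<lambda>s. s\<^sup>2 * h s)) / 2"
proof -
  have "integral {0..1} (\<lambda>s. kernel_k t s * h s)
      = integral {0..1} (\<lambda>s. t\<^sup>2 / 2 * ((1 - s)\<^sup>2 * (2 * s + 1) * h s) - t * (s * (1 - s)\<^sup>2 * h s)
        - 1 / 2 * ((max 0 (t - s))\<^sup>2 * h s))"
    by (intro integral_cong) (simp add: kernel_k_eq algebra_simps)
  also have "\<dots> = integral {0..1} (\<lambda>s. t\<^sup>2 / 2 * ((1 - s)\<^sup>2 * (2 * s + 1) * h s))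
      - integral {0..1} (\<lambda>s. t * (s * (1 - s)\<^sup>2 * h s)) - integral {0..1} (\<lambda>s. 1 / 2 * ((max 0 (t - s))\<^sup>2 * h s))"
  proof -
    have "(\<lambda>s. t\<^sup>2 / 2 * ((1 - s)\<^sup>2 * (2 * s + 1) * h s)) integrable_on {0..1}"
      "(\<lambda>s. t * (s * (1 - s)\<^sup>2 * h s)) integrable_on {0..1}"
      "(\<lambda>s. 1 / 2 * ((max 0 (t - s))\<^sup>2 * h s)) integrable_on {0..1}"
      by (intro integrable_continuous_interval continuous_intros h)+
    then show ?thesis
      by (simp only: Henstock_Kurzweil_Integration.integral_diff integrable_diff)
  qed
  finally show ?thesis
    by (simp add: integral_max_square[OF h t])
qed

text \<open>
  Differentiating \<open>t\<^sup>2 A\<^sub>0 - 2 t A\<^sub>1 + A\<^sub>2\<close>, where \<open>A\<^sub>j(t) = \<integral>\<^sub>0\<^sup>t s\<^sup>j h(s) ds\<close>, the terms that contain \<open>h(t)\<close> cancel, and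
  so they do once more in the next derivative. This is why the result is of class \<open>C\<^sup>2\<close> although \<open>h\<close> is
  only continuous.
\<close>

lemma
  fixes h :: "real \<Rightarrow> real"
  assumes h: "continuous_on {0..1} h" and t: "t \<in> {0..1}"
  shows C2_fun_hammerstein: "C2_fun (hammerstein a b h) t
      = gamma1 t * a + gamma2 t * b + integral {0..1} (\<lambda>s. kernel_k t s * h s)"
    and C2_D1_hammerstein: "C2_D1 (hammerstein a b h) t = (6 * t - 4) * a + (6 * t - 2) * b
      + t * integral {0..1} (\<lambda>s. (1 - s)\<^sup>2 * (2 * s + 1) * h s)
      - integral {0..1} (\<lambda>s. s * (1 - s)\<^sup>2 * h s)
      - (t * integral {0..t} h - integral {0..t} (\<lambda>s. s * h s))"
    and C2_D2_hammerstein: "C2_D2 (hammerstein a b h) t = 6 * (a + b)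
      + integral {0..1} (\<lambda>s. (1 - s)\<^sup>2 * (2 * s + 1) * h s) - integral {0..t} h"
proof -
  define B1 where "B1 = integral {0..1} (\<lambda>s. (1 - s)\<^sup>2 * (2 * s + 1) * h s)"
  define B2 where "B2 = integral {0..1} (\<lambda>s. s * (1 - s)\<^sup>2 * h s)"
  define A where "A j t = integral {0..t} (\<lambda>s. s ^ j * h s)" for j :: nat and t
  define u where "u t = gamma1 t * a + gamma2 t * b + integral {0..1} (\<lambda>s. kernel_k t s * h s)" for t
  define w where "w t = (1 - 4 * t + 3 * t\<^sup>2) * a + (- 2 * t + 3 * t\<^sup>2) * b + (t\<^sup>2 / 2 * B1 - t * B2
    - (t\<^sup>2 * A 0 t - 2 * t * A 1 t + A 2 t) / 2)" for t
  define u' where "u' t = (6 * t - 4) * a + (6 * t - 2) * b + t * B1 - B2 - (t * A 0 t - A 1 t)" for t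
  define u'' where "u'' t = 6 * (a + b) + B1 - A 0 t" for t
  have u_w: "u t = w t" if "t \<in> {0..1}" for t
    using integral_kernel_k[OF h that] by (simp add: u_def w_def gamma1_def gamma2_def A_def B1_def B2_def)
  have dA: "(A j has_real_derivative t ^ j * h t) (at t within {0..1})" if "t \<in> {0..1}" for j t
    unfolding A_def[abs_def]
    by (rule integral_has_real_derivative[OF _ that]) (intro continuous_intros h)
  have dw: "(w has_real_derivative u' t) (at t within {0..1})" if "t \<in> {0..1}" for t
    unfolding w_def[abs_def] u'_def
    by (rule derivative_eq_intros dA that refl | simp)+ (simp add: field_simps power2_eq_square)
  have d1: "(u has_real_derivative u' t) (at t within {0..1})" if t: "t \<in> {0..1}" for t
    by (rule has_field_derivative_transform_within[OF dw[OF t] zero_less_one t]) (use u_w in auto)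
  have d2: "(u' has_real_derivative u'' t) (at t within {0..1})" if "t \<in> {0..1}" for t
    unfolding u'_def[abs_def] u''_def
    by (auto intro!: derivative_eq_intros dA that simp: algebra_simps)
  have "continuous_on {0..1} (A 0)" using dA by (rule DERIV_continuous_on)
  then have cu: "continuous_on {0..1} u''" unfolding u''_def[abs_def] by (intro continuous_intros)
  have fun_eq: "C2_fun (hammerstein a b h) t = u t" if "t \<in> {0..1}" for t
    unfolding hammerstein_def u_def[symmetric, abs_def] by (rule C2_fun_C2_of[OF d1 d2 cu that])
  note D = C2_01_unique_derivs[OF fun_eq d1 d2 t]
  show "C2_fun (hammerstein a b h) t
      = gamma1 t * a + gamma2 t * b + integral {0..1} (\<lambda>s. kernel_k t s * h s)"
    using fun_eq[OF t] by (simp add: u_def)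
  show "C2_D1 (hammerstein a b h) t = (6 * t - 4) * a + (6 * t - 2) * b
      + t * integral {0..1} (\<lambda>s. (1 - s)\<^sup>2 * (2 * s + 1) * h s)
      - integral {0..1} (\<lambda>s. s * (1 - s)\<^sup>2 * h s)
      - (t * integral {0..t} h - integral {0..t} (\<lambda>s. s * h s))"
    using D(1) by (simp add: u'_def B1_def B2_def A_def)
  show "C2_D2 (hammerstein a b h) t = 6 * (a + b)
      + integral {0..1} (\<lambda>s. (1 - s)\<^sup>2 * (2 * s + 1) * h s) - integral {0..t} h"
    using D(2) by (simp add: u''_def B1_def A_def)
qed

lemma hammerstein_diff:
  assumes h: "continuous_on {0..1} h" "continuous_on {0..1} k"
  shows "hammerstein a b h - hammerstein c d k = hammerstein (a - c) (b - d) (\<lambda>s. h s - k s)"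
proof (rule C2_01_eqI)
  fix t :: real assume t: "t \<in> {0..1}"
  have hk: "continuous_on {0..1} (\<lambda>s. h s - k s)" by (intro continuous_intros h)
  have int: "(\<lambda>s. kernel_k t s * g s) integrable_on {0..1}" if "continuous_on {0..1} g" for g
    unfolding kernel_k_eq by (intro integrable_continuous_interval continuous_intros that) auto
  have "integral {0..1} (\<lambda>s. kernel_k t s * (h s - k s))
      = integral {0..1} (\<lambda>s. kernel_k t s * h s) - integral {0..1} (\<lambda>s. kernel_k t s * k s)"
    using Henstock_Kurzweil_Integration.integral_diff[OF int[OF h(1)] int[OF h(2)]]
    by (simp add: algebra_simps)
  then show "C2_fun (hammerstein a b h - hammerstein c d k) t
      = C2_fun (hammerstein (a - c) (b - d) (\<lambda>s. h s - k s)) t"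
    by (simp add: C2_01_diff[OF t] C2_fun_hammerstein[OF h(1) t] C2_fun_hammerstein[OF h(2) t]
        C2_fun_hammerstein[OF hk t] algebra_simps)
qed

lemma integral_weighted_bound:
  fixes h :: "real \<Rightarrow> real"
  assumes h: "continuous_on {0..1} h" and w: "continuous_on {0..1} w"
    and hM: "\<And>s. s \<in> {0..1} \<Longrightarrow> \<bar>h s\<bar> \<le> M" and w1: "\<And>s. s \<in> {0..1} \<Longrightarrow> \<bar>w s\<bar> \<le> 1"
    and xy: "0 \<le> x" "x \<le> y" "y \<le> 1"
  shows "\<bar>integral {x..y} (\<lambda>s. w s * h s)\<bar> \<le> M * (y - x)"
proof -
  have "norm (integral {x..y} (\<lambda>s. w s * h s)) \<le> M * (y - x)"
  proof (rule integral_bound[OF xy(2)])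
    show "continuous_on {x..y} (\<lambda>s. w s * h s)"
      by (rule continuous_on_subset[of "{0..1}"]) (use xy in \<open>auto intro!: continuous_intros h w\<close>)
    fix s assume "s \<in> {x..y}"
    then have s: "s \<in> {0..1}" using xy by auto
    have "\<bar>w s\<bar> * \<bar>h s\<bar> \<le> 1 * M" using hM[OF s] w1[OF s] by (intro mult_mono) auto
    then show "norm (w s * h s) \<le> M" by (simp add: abs_mult)
  qed
  then show ?thesis by simp
qed

lemma weight_bounds:
  fixes s :: real
  assumes "s \<in> {0..1}"
  shows "\<bar>(1 - s)\<^sup>2 * (2 * s + 1)\<bar> \<le> 1" "\<bar>s * (1 - s)\<^sup>2\<bar> \<le> 1"
proof -
  have "1 - (1 - s)\<^sup>2 * (2 * s + 1) = s\<^sup>2 * (3 - 2 * s)" by (simp add: power2_eq_square algebra_simps)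
  moreover have "0 \<le> s\<^sup>2 * (3 - 2 * s)" "0 \<le> (1 - s)\<^sup>2 * (2 * s + 1)" using assms by auto
  ultimately show "\<bar>(1 - s)\<^sup>2 * (2 * s + 1)\<bar> \<le> 1" by simp
  have "s * (1 - s)\<^sup>2 \<le> 1 * 1" using assms by (intro mult_mono power_le_one) auto
  then show "\<bar>s * (1 - s)\<^sup>2\<bar> \<le> 1" using assms by simp
qed

text \<open>
  The bounds place the image of a bounded set of data in one of the compact sets of
  \<open>compact_C2_01_Lipschitz\<close>. The Lipschitz constant comes from the term \<open>- \<integral>\<^sub>0\<^sup>t h\<close> of the second derivative.
\<close>

lemma
  fixes h :: "real \<Rightarrow> real"
  assumes h: "continuous_on {0..1} h" and M: "\<And>s. s \<in> {0..1} \<Longrightarrow> \<bar>h s\<bar> \<le> M"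
  shows C2_fun_hammerstein_0: "C2_fun (hammerstein a b h) 0 = a"
    and C2_D1_hammerstein_0_bound: "\<bar>C2_D1 (hammerstein a b h) 0\<bar> \<le> 4 * \<bar>a\<bar> + 2 * \<bar>b\<bar> + M"
    and C2_D2_hammerstein_bound: "t \<in> {0..1} \<Longrightarrow>
      \<bar>C2_D2 (hammerstein a b h) t\<bar> \<le> 6 * \<bar>a\<bar> + 6 * \<bar>b\<bar> + 2 * M"
    and C2_D2_hammerstein_Lipschitz: "s \<in> {0..1} \<Longrightarrow> t \<in> {0..1} \<Longrightarrow>
      \<bar>C2_D2 (hammerstein a b h) s - C2_D2 (hammerstein a b h) t\<bar> \<le> M * \<bar>s - t\<bar>"
proof -
  have M0: "0 \<le> M" using M[of 0] by simp
  have c1: "continuous_on {0..1} (\<lambda>s::real. (1 - s)\<^sup>2 * (2 * s + 1))"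
    and c2: "continuous_on {0..1} (\<lambda>s::real. s * (1 - s)\<^sup>2)"
    by (intro continuous_intros)+
  have B1: "\<bar>integral {0..1} (\<lambda>s. (1 - s)\<^sup>2 * (2 * s + 1) * h s)\<bar> \<le> M"
    using integral_weighted_bound[OF h c1 M weight_bounds(1), of 0 1] by simp
  have B2: "\<bar>integral {0..1} (\<lambda>s. s * (1 - s)\<^sup>2 * h s)\<bar> \<le> M"
    using integral_weighted_bound[OF h c2 M weight_bounds(2), of 0 1] by simp
  have A: "\<bar>integral {x..y} h\<bar> \<le> M * (y - x)" if "0 \<le> x" "x \<le> y" "y \<le> 1" for x y
    using integral_weighted_bound[OF h continuous_on_const[of _ 1] M _ that] by simp
  have AL: "\<bar>integral {0..y} h - integral {0..x} h\<bar> \<le> M * (y - x)"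
    if xy: "0 \<le> x" "x \<le> y" "y \<le> 1" for x y
  proof -
    have "h integrable_on {0..y}"
      by (rule integrable_continuous_interval[OF continuous_on_subset[OF h]]) (use xy in auto)
    then have "integral {0..x} h + integral {x..y} h = integral {0..y} h"
      using xy by (intro Henstock_Kurzweil_Integration.integral_combine)
    then show ?thesis using A[OF xy] by linarith
  qed
  show "C2_fun (hammerstein a b h) 0 = a"
    using C2_fun_hammerstein[OF h, of 0] integral_kernel_k[OF h, of 0]
    by (simp add: gamma1_def gamma2_def)
  show "\<bar>C2_D1 (hammerstein a b h) 0\<bar> \<le> 4 * \<bar>a\<bar> + 2 * \<bar>b\<bar> + M"
    using C2_D1_hammerstein[OF h, of 0] B2 by simp
  show "\<bar>C2_D2 (hammerstein a b h) t\<bar> \<le> 6 * \<bar>a\<bar> + 6 * \<bar>b\<bar> + 2 * M" if t: "t \<in> {0..1}"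
  proof -
    have "M * t \<le> M" using M0 t by (simp add: mult_left_le)
    then have "\<bar>integral {0..t} h\<bar> \<le> M" using A[of 0 t] t by simp
    then show ?thesis unfolding C2_D2_hammerstein[OF h t] using B1 by (simp add: abs_le_iff) linarith
  qed
  show "\<bar>C2_D2 (hammerstein a b h) s - C2_D2 (hammerstein a b h) t\<bar> \<le> M * \<bar>s - t\<bar>"
    if s: "s \<in> {0..1}" and t: "t \<in> {0..1}"
    unfolding C2_D2_hammerstein[OF h s] C2_D2_hammerstein[OF h t]
    using AL[of s t] AL[of t s] s t by (cases "s \<le> t") (auto simp: abs_minus_commute)
qed

lemma norm_hammerstein_le:
  assumes h: "continuous_on {0..1} h" and M: "\<And>s. s \<in> {0..1} \<Longrightarrow> \<bar>h s\<bar> \<le> M"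
  shows "norm (hammerstein a b h) \<le> 11 * \<bar>a\<bar> + 8 * \<bar>b\<bar> + 3 * M"
proof -
  have "norm (hammerstein a b h) \<le> \<bar>C2_fun (hammerstein a b h) 0\<bar> + \<bar>C2_D1 (hammerstein a b h) 0\<bar>
      + (6 * \<bar>a\<bar> + 6 * \<bar>b\<bar> + 2 * M)"
    by (rule C2_01_norm_le) (rule C2_D2_hammerstein_bound[OF h M])
  then show ?thesis
    using C2_fun_hammerstein_0[OF h M, of a b] C2_D1_hammerstein_0_bound[OF h M, of a b] by simp
qed

section \<open>The nonlinear operator\<close>

definition nemytskii :: "(real \<times> real \<times> real \<times> real \<Rightarrow> real) \<Rightarrow> C2_01 \<Rightarrow> real \<Rightarrow> real"
  where "nemytskii f u s = f (s, C2_fun u s, C2_D1 u s, C2_D2 u s)"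

lemma jet_in_Pi_box:
  assumes "norm u \<le> \<rho>" "s \<in> {0..1}"
  shows "(s, C2_fun u s, C2_D1 u s, C2_D2 u s) \<in> Pi_box \<rho>"
  using C2_01_bounds[OF assms(2), of u] assms by (auto simp: Pi_box_def abs_le_iff)

lemma compact_Pi_box: "compact (Pi_box \<rho>)"
  unfolding Pi_box_def by (intro compact_Times compact_Icc)

lemma continuous_on_nemytskii:
  assumes f: "continuous_on (Pi_box \<rho>) f" and u: "norm u \<le> \<rho>"
  shows "continuous_on {0..1} (nemytskii f u)"
  unfolding nemytskii_def[abs_def]
proof (rule continuous_on_compose2[OF f])
  show "continuous_on {0..1} (\<lambda>s. (s, C2_fun u s, C2_D1 u s, C2_D2 u s))"
    by (intro continuous_on_Pair continuous_on_id C2_01_derivs(3-5)[of 0 u]) simp_all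
  show "(\<lambda>s. (s, C2_fun u s, C2_D1 u s, C2_D2 u s)) ` {0..1} \<subseteq> Pi_box \<rho>"
    using jet_in_Pi_box[OF u] by blast
qed

lemma nemytskii_bounded:
  assumes f: "continuous_on (Pi_box \<rho>) f"
  obtains M where "\<And>u s. norm u \<le> \<rho> \<Longrightarrow> s \<in> {0..1} \<Longrightarrow> \<bar>nemytskii f u s\<bar> \<le> M"
proof -
  obtain M where "\<And>x. x \<in> Pi_box \<rho> \<Longrightarrow> norm (f x) \<le> M"
    using compact_imp_bounded[OF compact_continuous_image[OF f compact_Pi_box]]
    by (auto simp: bounded_iff)
  then have "norm (nemytskii f u s) \<le> M" if "norm u \<le> \<rho>" "s \<in> {0..1}" for u s
    unfolding nemytskii_def using jet_in_Pi_box[OF that] by blast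
  then show thesis using that[of M] by simp
qed

text \<open>
  Uniform continuity of \<open>f\<close> on the compact box turns closeness of the jets of \<open>u\<close> and \<open>v\<close> into
  closeness of the superpositions, uniformly in \<open>s\<close>.
\<close>

lemma nemytskii_uniformly_continuous:
  assumes f: "continuous_on (Pi_box \<rho>) f" and e: "0 < e"
  obtains d where "0 < d" "\<And>u v s. norm u \<le> \<rho> \<Longrightarrow> norm v \<le> \<rho> \<Longrightarrow> norm (u - v) < d \<Longrightarrow>
    s \<in> {0..1} \<Longrightarrow> \<bar>nemytskii f u s - nemytskii f v s\<bar> \<le> e"
proof -
  obtain d where d: "d > 0" and unif: "\<And>x y. x \<in> Pi_box \<rho> \<Longrightarrow> y \<in> Pi_box \<rho> \<Longrightarrow> dist y x < d \<Longrightarrow> dist (f y) (f x) < e"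
    using compact_uniformly_continuous[OF f compact_Pi_box] e unfolding uniformly_continuous_on_def by metis
  show thesis
  proof (rule that[of "d / 3"])
    show "0 < d / 3" using d by simp
    fix u v :: C2_01 and s :: real
    assume u: "norm u \<le> \<rho>" and v: "norm v \<le> \<rho>" and uv: "norm (u - v) < d / 3"
      and s: "s \<in> {0..1}"
    let ?x = "(s, C2_fun u s, C2_D1 u s, C2_D2 u s)" and ?y = "(s, C2_fun v s, C2_D1 v s, C2_D2 v s)"
    have "?x - ?y = (0, C2_fun (u - v) s, C2_D1 (u - v) s, C2_D2 (u - v) s)"
      using C2_01_diff[OF s, of u v] by simp
    then have "norm (?x - ?y) \<le> \<bar>C2_fun (u - v) s\<bar> + (\<bar>C2_D1 (u - v) s\<bar> + \<bar>C2_D2 (u - v) s\<bar>)"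
      using norm_Pair_le[of "C2_fun (u - v) s" "(C2_D1 (u - v) s, C2_D2 (u - v) s)"]
        norm_Pair_le[of "C2_D1 (u - v) s" "C2_D2 (u - v) s"] by simp
    also have "\<dots> < d" using C2_01_bounds[OF s, of "u - v"] uv by linarith
    finally have "dist ?x ?y < d" by (simp only: dist_norm)
    then have "dist (f ?x) (f ?y) < e"
      by (rule unif[OF jet_in_Pi_box[OF v s] jet_in_Pi_box[OF u s]])
    then show "\<bar>nemytskii f u s - nemytskii f v s\<bar> \<le> e"
      by (simp add: nemytskii_def dist_real_def)
  qed
qed

definition hammerstein_operator ::
  "(real \<times> real \<times> real \<times> real \<Rightarrow> real) \<Rightarrow> (C2_01 \<Rightarrow> real) \<Rightarrow> (C2_01 \<Rightarrow> real) \<Rightarrow> C2_01 \<Rightarrow> C2_01"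
  where "hammerstein_operator f H1 H2 u = hammerstein (H1 u) (H2 u) (nemytskii f u)"

lemma is_eigenpair_if_eigenvector:
  assumes f: "continuous_on (Pi_box \<rho>) f" and u: "norm u \<le> \<rho>" "u \<noteq> 0"
    and eq: "u = lam *\<^sub>R hammerstein_operator f H1 H2 u"
  shows "is_eigenpair f H1 H2 lam u"
  unfolding is_eigenpair_def
proof (intro conjI ballI)
  show "norm u > 0" using u(2) by simp
  fix t :: real assume t: "t \<in> {0..1}"
  have "C2_fun u t = lam * C2_fun (hammerstein_operator f H1 H2 u) t"
    by (subst eq) (simp add: scaleR_C2_01.rep_eq)
  then show "C2_fun u t = lam * (gamma1 t * H1 u + gamma2 t * H2 u +
      integral {0..1} (\<lambda>s. kernel_k t s * f (s, C2_fun u s, C2_D1 u s, C2_D2 u s)))"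
    using C2_fun_hammerstein[OF continuous_on_nemytskii[OF f u(1)] t]
    by (simp add: hammerstein_operator_def nemytskii_def)
qed

text \<open>
  The operator is linear and bounded in the data \<open>(a, b, h)\<close>, which depend continuously on \<open>u\<close>.
  The numbers 44, 32 and 12 make each term of the bound in \<open>norm_hammerstein_le\<close> at most \<open>e/4\<close>.
\<close>

lemma continuous_on_hammerstein_operator:
  assumes f: "continuous_on (Pi_box \<rho>) f"
    and H: "continuous_on S H1" "continuous_on S H2" and S: "S \<subseteq> cball 0 \<rho>"
  shows "continuous_on S (hammerstein_operator f H1 H2)"
  unfolding continuous_on_iff
proof (intro ballI allI impI)
  fix v and e :: real assume v: "v \<in> S" and e: "0 < e"
  obtain d1 where d1: "0 < d1" "\<And>u. u \<in> S \<Longrightarrow> dist u v < d1 \<Longrightarrow> dist (H1 u) (H1 v) < e / 44"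
    using H(1) v e unfolding continuous_on_iff by (metis divide_pos_pos zero_less_numeral)
  obtain d2 where d2: "0 < d2" "\<And>u. u \<in> S \<Longrightarrow> dist u v < d2 \<Longrightarrow> dist (H2 u) (H2 v) < e / 32"
    using H(2) v e unfolding continuous_on_iff by (metis divide_pos_pos zero_less_numeral)
  obtain d3 where d3: "0 < d3" "\<And>u v s. norm u \<le> \<rho> \<Longrightarrow> norm v \<le> \<rho> \<Longrightarrow> norm (u - v) < d3 \<Longrightarrow>
    s \<in> {0..1} \<Longrightarrow> \<bar>nemytskii f u s - nemytskii f v s\<bar> \<le> e / 12"
    using nemytskii_uniformly_continuous[OF f, of "e / 12"] e by auto
  show "\<exists>d>0. \<forall>u\<in>S. dist u v < d \<longrightarrow>
      dist (hammerstein_operator f H1 H2 u) (hammerstein_operator f H1 H2 v) < e"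
  proof (intro exI[of _ "min d1 (min d2 d3)"] conjI ballI impI)
    show "0 < min d1 (min d2 d3)" using d1(1) d2(1) d3(1) by simp
    fix u assume u: "u \<in> S" and near: "dist u v < min d1 (min d2 d3)"
    have nu: "norm u \<le> \<rho>" and nv: "norm v \<le> \<rho>" using u v S by (auto simp: dist_norm)
    note cu = continuous_on_nemytskii[OF f nu] and cv = continuous_on_nemytskii[OF f nv]
    have "norm (hammerstein_operator f H1 H2 u - hammerstein_operator f H1 H2 v)
        \<le> 11 * \<bar>H1 u - H1 v\<bar> + 8 * \<bar>H2 u - H2 v\<bar> + 3 * (e / 12)"
      unfolding hammerstein_operator_def hammerstein_diff[OF cu cv]
    proof (rule norm_hammerstein_le)
      show "continuous_on {0..1} (\<lambda>s. nemytskii f u s - nemytskii f v s)"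
        by (intro continuous_intros cu cv)
      show "\<bar>nemytskii f u s - nemytskii f v s\<bar> \<le> e / 12" if "s \<in> {0..1}" for s
        using d3(2)[OF nu nv _ that] near by (simp add: dist_norm)
    qed
    also have "\<dots> < e"
      using d1(2)[OF u] d2(2)[OF u] near e by (simp add: dist_real_def)
    finally show "dist (hammerstein_operator f H1 H2 u) (hammerstein_operator f H1 H2 v) < e"
      by (simp add: dist_norm)
  qed
qed

lemma hammerstein_operator_compact:
  assumes f: "continuous_on (Pi_box \<rho>) f"
    and H: "bounded (H1 ` cball 0 \<rho>)" "bounded (H2 ` cball 0 \<rho>)"
  obtains K where "compact K" "hammerstein_operator f H1 H2 ` cball 0 \<rho> \<subseteq> K"
proof -
  obtain M where M: "\<And>u s. norm u \<le> \<rho> \<Longrightarrow> s \<in> {0..1} \<Longrightarrow> \<bar>nemytskii f u s\<bar> \<le> M"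
    using nemytskii_bounded[OF f] by blast
  obtain A B where "\<forall>u\<in>cball 0 \<rho>. \<bar>H1 u\<bar> \<le> A" "\<forall>u\<in>cball 0 \<rho>. \<bar>H2 u\<bar> \<le> B"
    using H by (auto simp: bounded_iff)
  then have AB: "\<bar>H1 u\<bar> \<le> A" "\<bar>H2 u\<bar> \<le> B" if "norm u \<le> \<rho>" for u
    using that by simp_all
  show thesis
  proof (rule that[OF compact_C2_01_Lipschitz[of "6 * A + 6 * B + 2 * M"]], safe)
    fix u :: C2_01 assume "u \<in> cball 0 \<rho>"
    then have u: "norm u \<le> \<rho>" by simp
    note h = continuous_on_nemytskii[OF f u] and bd = M[OF u]
    have pos: "0 \<le> M" using bd[of 0] by simp
    note ab = AB[OF u]
    show "\<bar>C2_fun (hammerstein_operator f H1 H2 u) 0\<bar> \<le> 6 * A + 6 * B + 2 * M"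
      unfolding hammerstein_operator_def
      using C2_fun_hammerstein_0[OF h bd, of "H1 u" "H2 u"] ab pos by linarith
    show "\<bar>C2_D1 (hammerstein_operator f H1 H2 u) 0\<bar> \<le> 6 * A + 6 * B + 2 * M"
      unfolding hammerstein_operator_def
      using C2_D1_hammerstein_0_bound[OF h bd, of "H1 u" "H2 u"] ab pos by linarith
    fix s assume s: "s \<in> {0..1::real}"
    show "\<bar>C2_D2 (hammerstein_operator f H1 H2 u) s\<bar> \<le> 6 * A + 6 * B + 2 * M"
      unfolding hammerstein_operator_def
      using C2_D2_hammerstein_bound[OF h bd s, of "H1 u" "H2 u"] ab by linarith
    fix t assume t: "t \<in> {0..1::real}"
    have "M * \<bar>s - t\<bar> \<le> (6 * A + 6 * B + 2 * M) * \<bar>s - t\<bar>"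
      using ab pos by (intro mult_right_mono) linarith+
    then show "\<bar>C2_D2 (hammerstein_operator f H1 H2 u) s - C2_D2 (hammerstein_operator f H1 H2 u) t\<bar>
        \<le> (6 * A + 6 * B + 2 * M) * \<bar>s - t\<bar>"
      unfolding hammerstein_operator_def
      using C2_D2_hammerstein_Lipschitz[OF h bd s t, of "H1 u" "H2 u"] by linarith
  qed
qed

lemma C2_01_sphere_nonempty:
  assumes "0 < \<rho>"
  shows "sphere (0 :: C2_01) \<rho> \<noteq> {}"
proof -
  obtain v where v: "C2_fun v 0 = 1"
    using C2_01_prescribed[of "\<lambda>_. 0" 1 0] by auto
  then have "v \<noteq> 0" by (auto simp: zero_C2_01.rep_eq)
  then have "(\<rho> / norm v) *\<^sub>R v \<in> sphere 0 \<rho>" using assms by simp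
  then show ?thesis by blast
qed

text \<open>
  These two values are the functionals behind the integral conditions of the theorem. At \<open>t = 1\<close> the
  weight is \<open>(1-s)\<^sup>2 (2s+1) - 1 = - s\<^sup>2 (3-2s)\<close>, which is the reason why the second condition goes with a
  nonpositive nonlinearity.
\<close>

lemma C2_D2_hammerstein_ends:
  assumes h: "continuous_on {0..1} h"
  shows "C2_D2 (hammerstein a b h) 0
      = 6 * (a + b) + integral {0..1} (\<lambda>s. (1 - s)\<^sup>2 * (2 * s + 1) * h s)"
    and "C2_D2 (hammerstein a b h) 1 = 6 * (a + b) + integral {0..1} (\<lambda>s. s\<^sup>2 * (3 - 2 * s) * (- h s))"
proof -
  show "C2_D2 (hammerstein a b h) 0
      = 6 * (a + b) + integral {0..1} (\<lambda>s. (1 - s)\<^sup>2 * (2 * s + 1) * h s)"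
    using C2_D2_hammerstein[OF h, of 0] by simp
  have "integral {0..1} (\<lambda>s. (1 - s)\<^sup>2 * (2 * s + 1) * h s) - integral {0..1} h
      = integral {0..1} (\<lambda>s. (1 - s)\<^sup>2 * (2 * s + 1) * h s - h s)"
    by (intro Henstock_Kurzweil_Integration.integral_diff[symmetric] integrable_continuous_interval continuous_intros h)
  also have "\<dots> = integral {0..1} (\<lambda>s. s\<^sup>2 * (3 - 2 * s) * (- h s))"
    by (intro integral_cong) (simp add: power2_eq_square algebra_simps)
  finally show "C2_D2 (hammerstein a b h) 1
      = 6 * (a + b) + integral {0..1} (\<lambda>s. s\<^sup>2 * (3 - 2 * s) * (- h s))"
    using C2_D2_hammerstein[OF h, of 1] by simp
qed

lemma integral_weighted_mono:
  fixes g h w :: "real \<Rightarrow> real"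
  assumes g: "continuous_on {0..1} g" and h: "continuous_on {0..1} h" and w: "continuous_on {0..1} w"
    and w0: "\<And>s. s \<in> {0..1} \<Longrightarrow> 0 \<le> w s" and gh: "\<And>s. s \<in> {0..1} \<Longrightarrow> g s \<le> h s"
  shows "integral {0..1} (\<lambda>s. w s * g s) \<le> integral {0..1} (\<lambda>s. w s * h s)"
proof (rule integral_le)
  show "(\<lambda>s. w s * g s) integrable_on {0..1}" "(\<lambda>s. w s * h s) integrable_on {0..1}"
    by (intro integrable_continuous_interval continuous_intros g h w)+
  show "w s * g s \<le> w s * h s" if "s \<in> {0..1}" for s
    using w0[OF that] gh[OF that] by (rule mult_left_mono[rotated])
qed

section \<open>Positive and negative eigenvalues\<close>

theorem theorem2p4:
  fixes \<rho> :: real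
    and f :: "real \<times> real \<times> real \<times> real \<Rightarrow> real"
    and \<delta> :: "real \<Rightarrow> real"
    and H1 H2 :: "C2_01 \<Rightarrow> real"
    and \<eta>1 \<eta>2 :: real
  assumes "\<rho> > 0"
    and "continuous_on (Pi_box \<rho>) f"
    and "continuous_on {0..1} \<delta>"
    and "\<forall>t\<in>{0..1}. \<delta> t \<ge> 0"
    and "(\<forall>(t, u, v, w)\<in>Pi_box \<rho>. f (t, u, v, w) \<ge> \<delta> t) \<or>
         (\<forall>(t, u, v, w)\<in>Pi_box \<rho>. - f (t, u, v, w) \<ge> \<delta> t)"
    and "continuous_on (cball 0 \<rho>) H1" and "bounded (H1 ` cball 0 \<rho>)"
    and "continuous_on (cball 0 \<rho>) H2" and "bounded (H2 ` cball 0 \<rho>)"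
    and "\<forall>u\<in>sphere 0 \<rho>. H1 u \<ge> \<eta>1"
    and "\<forall>u\<in>sphere 0 \<rho>. H2 u \<ge> \<eta>2"
    and "((\<forall>(t, u, v, w)\<in>Pi_box \<rho>. f (t, u, v, w) \<ge> \<delta> t) \<and>
           6 * (\<eta>1 + \<eta>2) + integral {0..1} (\<lambda>s. (1 - s)\<^sup>2 * (2 * s + 1) * \<delta> s) > 0) \<or>
         ((\<forall>(t, u, v, w)\<in>Pi_box \<rho>. - f (t, u, v, w) \<ge> \<delta> t) \<and>
           6 * (\<eta>1 + \<eta>2) + integral {0..1} (\<lambda>s. s\<^sup>2 * (3 - 2 * s) * \<delta> s) > 0)"
  shows "(\<exists>lam u. lam > 0 \<and> u \<in> sphere 0 \<rho> \<and> is_eigenpair f H1 H2 lam u) \<and>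
         (\<exists>lam u. lam < 0 \<and> u \<in> sphere 0 \<rho> \<and> is_eigenpair f H1 H2 lam u)"
proof -
  note f = assms(2)
  let ?T = "hammerstein_operator f H1 H2"
  have sub: "sphere (0 :: C2_01) \<rho> \<subseteq> cball 0 \<rho>" by auto
  obtain K where K: "compact K" "?T ` cball 0 \<rho> \<subseteq> K"
    using hammerstein_operator_compact[OF f assms(7,9)] by blast
  have cont: "continuous_on (sphere 0 \<rho>) ?T"
    by (rule continuous_on_hammerstein_operator[OF f continuous_on_subset[OF assms(6) sub]
          continuous_on_subset[OF assms(8) sub] sub])
  have nem: "continuous_on {0..1} (nemytskii f u)" if "u \<in> sphere 0 \<rho>" for u
    using continuous_on_nemytskii[OF f] that by simp
  have jet: "(s, C2_fun u s, C2_D1 u s, C2_D2 u s) \<in> Pi_box \<rho>" if "u \<in> sphere 0 \<rho>" "s \<in> {0..1}" for u s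
    using jet_in_Pi_box[of u \<rho> s] that by simp
  have eta: "6 * (\<eta>1 + \<eta>2) \<le> 6 * (H1 u + H2 u)" if "u \<in> sphere 0 \<rho>" for u
    using bspec[OF assms(10) that] bspec[OF assms(11) that] by simp
  \<comment> \<open>The functional is \<open>u''(0)\<close> if \<open>f\<close> is bounded below by \<open>\<delta>\<close>, and \<open>u''(1)\<close> if \<open>- f\<close> is.\<close>
  have "\<exists>t\<in>{0..1}. \<exists>c>0. \<forall>u\<in>sphere 0 \<rho>. c \<le> C2_D2 (?T u) t"
    using assms(12)
  proof (elim disjE conjE)
    let ?c = "6 * (\<eta>1 + \<eta>2) + integral {0..1} (\<lambda>s. (1 - s)\<^sup>2 * (2 * s + 1) * \<delta> s)"
    assume low: "\<forall>(t, u, v, w)\<in>Pi_box \<rho>. f (t, u, v, w) \<ge> \<delta> t" and c: "?c > 0"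
    have "?c \<le> C2_D2 (?T u) 0" if u: "u \<in> sphere 0 \<rho>" for u
    proof -
      have "integral {0..1} (\<lambda>s. (1 - s)\<^sup>2 * (2 * s + 1) * \<delta> s)
          \<le> integral {0..1} (\<lambda>s. (1 - s)\<^sup>2 * (2 * s + 1) * nemytskii f u s)"
      proof (rule integral_weighted_mono[OF assms(3) nem[OF u]])
        show "\<delta> s \<le> nemytskii f u s" if "s \<in> {0..1}" for s
          using bspec[OF low jet[OF u that]] by (simp add: nemytskii_def)
        show "continuous_on {0..1} (\<lambda>s::real. (1 - s)\<^sup>2 * (2 * s + 1))" by (intro continuous_intros)
        show "0 \<le> (1 - s)\<^sup>2 * (2 * s + 1)" if "s \<in> {0..1}" for s :: real using that by simp
      qed
      then show ?thesis
        using eta[OF u] by (simp add: hammerstein_operator_def C2_D2_hammerstein_ends(1)[OF nem[OF u]])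
    qed
    then show ?thesis using c by (intro bexI[of _ 0] exI[of _ ?c]) auto
  next
    let ?c = "6 * (\<eta>1 + \<eta>2) + integral {0..1} (\<lambda>s. s\<^sup>2 * (3 - 2 * s) * \<delta> s)"
    assume low: "\<forall>(t, u, v, w)\<in>Pi_box \<rho>. - f (t, u, v, w) \<ge> \<delta> t" and c: "?c > 0"
    have "?c \<le> C2_D2 (?T u) 1" if u: "u \<in> sphere 0 \<rho>" for u
    proof -
      have "integral {0..1} (\<lambda>s. s\<^sup>2 * (3 - 2 * s) * \<delta> s)
          \<le> integral {0..1} (\<lambda>s. s\<^sup>2 * (3 - 2 * s) * (- nemytskii f u s))"
      proof (rule integral_weighted_mono[OF assms(3) continuous_on_minus[OF nem[OF u]]])
        show "\<delta> s \<le> - nemytskii f u s" if "s \<in> {0..1}" for s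
          using bspec[OF low jet[OF u that]] by (simp add: nemytskii_def)
        show "continuous_on {0..1} (\<lambda>s::real. s\<^sup>2 * (3 - 2 * s))" by (intro continuous_intros)
        show "0 \<le> s\<^sup>2 * (3 - 2 * s)" if "s \<in> {0..1}" for s :: real using that by simp
      qed
      then show ?thesis
        unfolding hammerstein_operator_def C2_D2_hammerstein_ends(2)[OF nem[OF u]]
        using eta[OF u] by linarith
    qed
    then show ?thesis using c by (intro bexI[of _ 1] exI[of _ ?c]) auto
  qed
  then obtain t c where t: "t \<in> {0..1::real}" and c: "0 < c"
    and low: "\<And>u. u \<in> sphere 0 \<rho> \<Longrightarrow> c \<le> C2_D2 (?T u) t"
    by blast
  have eig: "is_eigenpair f H1 H2 lam u" if "u \<in> sphere 0 \<rho>" "u = lam *\<^sub>R ?T u" for lam u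
    by (rule is_eigenpair_if_eigenvector[OF f _ _ that(2)]) (use that(1) assms(1) in auto)
  have "?T ` sphere 0 \<rho> \<subseteq> K" using K(2) sub by blast
  from birkhoff_kellogg_functional_both_signs[OF assms(1) C2_01_sphere_nonempty[OF assms(1)] cont K(1)
      this bounded_linear_C2_D2[OF t] c low]
  show ?thesis using eig by blast
qed

end
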